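(* Let $F(z)=D+C(zI-A)^{-1}B$ with $(C,A)$ observable. Assume that the columns of the function $H_{fzk}(zI-\Lambda_{fzk})^{-1}$ provide a basis in $Z(F)\oplus\mathcal W(\ker F)$, and let $\Pi_{fzk}$ be the corresponding solution of $$\begin{bmatrix}A&B\\C&D\end{bmatrix}\begin{bmatrix}\Pi_{fzk}\\H_{fzk}\end{bmatrix}=\begin{bmatrix}\Pi_{fzk}\Lambda_{fzk}\\0\end{bmatrix}.$$ Consider a maximal solution $(R_0,\alpha_0)$ of the equation $$\begin{bmatrix}A&B\\C&D\end{bmatrix}\begin{bmatrix}0\\R_0\end{bmatrix}=\begin{bmatrix}\Pi_{fzk}\alpha_0\\0\end{bmatrix},$$ maximality being meant in the sense of subspace inclusion for $\operatorname{Im}R_0$. Then the equivalence classes in $\mathcal W(\ker F)$ are exactly those determined by the functions $$H_{fzk}(zI-\Lambda_{fzk})^{-1}\beta,\qquad \beta\in\langle\Lambda_{fzk}\mid\alpha_0\rangle=\operatorname{Im}\bigl[\alpha_0,\Lambda_{fzk}\alpha_0,\Lambda_{fzk}^2\alpha_0,\dots\bigr].$$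
   Context: $A\in\mathbb C^{n\times n}$, $B\in\mathbb C^{n\times q}$, $C\in\mathbb C^{p\times n}$, $D\in\mathbb C^{p\times q}$. $\Omega U=\mathbb C[z]^q$, $\Omega Y=\mathbb C[z]^p$; $z^{-1}\Omega_\infty U$ is the set of strictly proper rational $q$-tuples; $\ker F=\{g\in\mathbb C(z)^q:Fg=0\}$; $F^{-1}(\Omega Y)=\{g\in\mathbb C(z)^q:Fg\in\Omega Y\}$; $\pi_-$ takes the strictly proper part of a rational tuple. $Z(F)=(F^{-1}(\Omega Y)+\Omega U)/(\ker F+\Omega U)$ and $\mathcal W(\ker F)=\pi_-(\ker F)/(\ker F\cap z^{-1}\Omega_\infty U)$. The space $Z(F)\oplus\mathcal W(\ker F)$ is identified with the space of strictly proper elements of $F^{-1}(\Omega Y)+\Omega U$ modulo $\ker F\cap z^{-1}\Omega_\infty U$; "the columns provide a basis" means they belong to $F^{-1}(\Omega Y)+\Omega U$ and their classes form a basis of this quotient. Such a basis determines a unique solution $\Pi_{fzk}$ of the displayed equation, and it has trivial kernel. A class in $\mathcal W(\ker F)$ is thus viewed as a class of strictly proper functions modulo $\ker F\cap z^{-1}\Omega_\infty U$. *)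

theory Defs
  imports
    "Jordan_Normal_Form.Matrix_Kernel"
    "Jordan_Normal_Form.Char_Poly"
    "HOL-Algebra.AbelCoset"
    "HOL-Computational_Algebra.Polynomial_Factorial"
begin

type_synonym ratfun = "complex poly fract"

definition const_fract :: "complex \<Rightarrow> ratfun" where
  "const_fract c = to_fract [:c:]"

abbreviation ratmat :: "complex mat \<Rightarrow> ratfun mat" where
  "ratmat \<equiv> map_mat const_fract"

abbreviation ratvec :: "complex vec \<Rightarrow> ratfun vec" where
  "ratvec \<equiv> map_vec const_fract"

definition z_fract :: ratfun where
  "z_fract = to_fract [:0, 1:]"

definition pencil :: "complex mat \<Rightarrow> ratfun mat" where
  "pencil A = z_fract \<cdot>\<^sub>m 1\<^sub>m (dim_row A) - ratmat A"

text \<open>For a square matrix the inverse always exists over \<open>\<complex>(z)\<close>,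
  see \<open>resolvent_inverse\<close> below.\<close>

definition resolvent :: "complex mat \<Rightarrow> ratfun mat" where
  "resolvent A = the (mat_inverse (pencil A))"

definition transfer_function ::
    "complex mat \<Rightarrow> complex mat \<Rightarrow> complex mat \<Rightarrow> complex mat \<Rightarrow> ratfun mat" where
  "transfer_function A B C D = ratmat D + ratmat C * resolvent A * ratmat B"

definition observable :: "complex mat \<Rightarrow> complex mat \<Rightarrow> bool" where
  "observable C A \<longleftrightarrow>
    (\<Inter>k. mat_kernel (C * A ^\<^sub>m k)) = {0\<^sub>v (dim_row A)}"

definition strictly_proper :: "ratfun \<Rightarrow> bool" where
  "strictly_proper f \<longleftrightarrow> (\<exists>a b. b \<noteq> 0 \<and> degree a < degree b \<and> f = Fract a b)"

text \<open>Well defined by \<open>strictly_proper_part_ex1\<close> below.\<close>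

definition strictly_proper_part :: "ratfun \<Rightarrow> ratfun" where
  "strictly_proper_part f = (THE s. strictly_proper s \<and> f - s \<in> range to_fract)"

definition pi_minus :: "ratfun vec \<Rightarrow> ratfun vec" where
  "pi_minus = map_vec strictly_proper_part"

definition polynomial_vecs :: "nat \<Rightarrow> ratfun vec set" where
  "polynomial_vecs q = {v \<in> carrier_vec q. \<forall>i<q. v $ i \<in> range to_fract}"

definition strictly_proper_vecs :: "nat \<Rightarrow> ratfun vec set" where
  "strictly_proper_vecs q = {v \<in> carrier_vec q. \<forall>i<q. strictly_proper (v $ i)}"

text \<open>The space \<open>\<complex>(z)\<^sup>q\<close> as a vector space over \<open>\<complex>\<close> (not over \<open>\<complex>(z)\<close>).\<close>

definition rational_vecs :: "nat \<Rightarrow> (complex, ratfun vec) module" where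
  "rational_vecs q = \<lparr>
    carrier = carrier_vec q,
    monoid.mult = undefined,
    one = undefined,
    zero = 0\<^sub>v q,
    add = (+),
    module.smult = (\<lambda>c v. const_fract c \<cdot>\<^sub>v v)\<rparr>"

text \<open>The quotient \<open>V / W\<close> of subspaces \<open>W \<subseteq> V\<close> of \<open>M\<close>; its elements are the cosets \<open>W + v\<close>.\<close>

definition quotient_space ::
    "('a, 'v) module \<Rightarrow> 'v set \<Rightarrow> 'v set \<Rightarrow> ('a, 'v set) module" where
  "quotient_space M V W = \<lparr>
    carrier = a_r_coset M W ` V,
    monoid.mult = undefined,
    one = undefined,
    zero = W,
    add = set_add M,
    module.smult = (\<lambda>c X. \<Union>x\<in>X. a_r_coset M W (module.smult M c x))\<rparr>"

definition inverse_image_poly :: "ratfun mat \<Rightarrow> ratfun vec set" where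
  "inverse_image_poly F =
    {g \<in> carrier_vec (dim_col F). F *\<^sub>v g \<in> polynomial_vecs (dim_row F)}"

definition strictly_proper_kernel :: "ratfun mat \<Rightarrow> ratfun vec set" where
  "strictly_proper_kernel F = mat_kernel F \<inter> strictly_proper_vecs (dim_col F)"

text \<open>The class \<open>g + (ker F \<inter> z\<^sup>-\<^sup>1\<Omega>\<^sub>\<infinity>U)\<close>.\<close>

definition kernel_class :: "ratfun mat \<Rightarrow> ratfun vec \<Rightarrow> ratfun vec set" where
  "kernel_class F = a_r_coset (rational_vecs (dim_col F)) (strictly_proper_kernel F)"

definition fzk_numerator :: "ratfun mat \<Rightarrow> ratfun vec set" where
  "fzk_numerator F =
    set_add (rational_vecs (dim_col F)) (inverse_image_poly F) (polynomial_vecs (dim_col F))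
      \<inter> strictly_proper_vecs (dim_col F)"

text \<open>The space \<open>Z(F) \<oplus> W(ker F)\<close>, identified with the strictly proper elements of
  \<open>F\<^sup>-\<^sup>1(\<Omega>Y) + \<Omega>U\<close> modulo \<open>ker F \<inter> z\<^sup>-\<^sup>1\<Omega>\<^sub>\<infinity>U\<close>.\<close>

definition fzk_space :: "ratfun mat \<Rightarrow> (complex, ratfun vec set) module" where
  "fzk_space F = quotient_space (rational_vecs (dim_col F))
    (fzk_numerator F) (strictly_proper_kernel F)"

text \<open>The space \<open>W(ker F) = \<pi>\<^sub>-(ker F) / (ker F \<inter> z\<^sup>-\<^sup>1\<Omega>\<^sub>\<infinity>U)\<close>.\<close>

definition W_ker :: "ratfun mat \<Rightarrow> (complex, ratfun vec set) module" where
  "W_ker F = quotient_space (rational_vecs (dim_col F))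
    (pi_minus ` mat_kernel F) (strictly_proper_kernel F)"

text \<open>Distinctness is required since the columns form a basis as a family,
  whereas the library's \<open>basis\<close> is a predicate on sets.\<close>

definition columns_basis_fzk :: "ratfun mat \<Rightarrow> ratfun mat \<Rightarrow> bool" where
  "columns_basis_fzk F G \<longleftrightarrow>
    set (cols G) \<subseteq> fzk_numerator F \<and>
    distinct (map (kernel_class F) (cols G)) \<and>
    vectorspace.basis class_ring (fzk_space F) (kernel_class F ` set (cols G))"

definition zero_state_solution ::
    "complex mat \<Rightarrow> complex mat \<Rightarrow> complex mat \<Rightarrow> complex mat \<Rightarrow> complex mat
      \<Rightarrow> complex mat \<Rightarrow> complex mat \<Rightarrow> bool" where
  "zero_state_solution A B C D P R \<alpha> \<longleftrightarrow>
    (\<exists>k. R \<in> carrier_mat (dim_col B) k \<and> \<alpha> \<in> carrier_mat (dim_col P) k \<and>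
      four_block_mat A B C D * (0\<^sub>m (dim_row A) k @\<^sub>r R) = (P * \<alpha>) @\<^sub>r 0\<^sub>m (dim_row C) k)"

text \<open>The number of columns is not fixed: competitors may have any number of columns.\<close>

definition maximal_zero_state_solution ::
    "complex mat \<Rightarrow> complex mat \<Rightarrow> complex mat \<Rightarrow> complex mat \<Rightarrow> complex mat
      \<Rightarrow> complex mat \<Rightarrow> complex mat \<Rightarrow> bool" where
  "maximal_zero_state_solution A B C D P R\<^sub>0 \<alpha>\<^sub>0 \<longleftrightarrow>
    zero_state_solution A B C D P R\<^sub>0 \<alpha>\<^sub>0 \<and>
    (\<forall>R \<alpha>. zero_state_solution A B C D P R \<alpha> \<longrightarrow>
      vec_space.col_space (dim_col B) R\<^sub>0 \<subseteq> vec_space.col_space (dim_col B) R \<longrightarrow>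
      vec_space.col_space (dim_col B) R = vec_space.col_space (dim_col B) R\<^sub>0)"

text \<open>The image of the infinite block row \<open>[\<alpha>, \<Lambda> \<alpha>, \<Lambda>\<^sup>2 \<alpha>, \<dots>]\<close>.\<close>

definition reachable_space :: "complex mat \<Rightarrow> complex mat \<Rightarrow> complex vec set" where
  "reachable_space \<Lambda> \<alpha> =
    LinearCombinations.module.span class_ring (module_vec TYPE(complex) (dim_row \<Lambda>))
      (\<Union>i. set (cols (\<Lambda> ^\<^sub>m i * \<alpha>)))"

lemma pencil_carrier: "A \<in> carrier_mat n n \<Longrightarrow> pencil A \<in> carrier_mat n n"
  by (auto simp: pencil_def)

lemma pencil_eq:
  assumes "A \<in> carrier_mat n n"
  shows "pencil A = map_mat to_fract (char_poly_matrix A)"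
  using assms
  by (intro eq_matI)
    (auto simp: pencil_def char_poly_matrix_def z_fract_def const_fract_def
       simp flip: to_fract_diff to_fract_add to_fract_uminus)

lemma det_pencil:
  assumes "A \<in> carrier_mat n n"
  shows "det (pencil A) \<noteq> 0"
proof -
  interpret to_fract: inj_idom_hom "to_fract :: complex poly \<Rightarrow> _"
    by unfold_locales auto
  have "det (pencil A) = to_fract (char_poly A)"
    unfolding pencil_eq[OF assms] char_poly_def by (simp add: to_fract.hom_det)
  moreover have "char_poly A \<noteq> 0"
    using degree_monic_char_poly[OF assms] by auto
  ultimately show ?thesis by simp
qed

lemma resolvent_inverse:
  assumes A: "A \<in> carrier_mat n n"
  shows "resolvent A \<in> carrier_mat n n"
    and "pencil A * resolvent A = 1\<^sub>m n" and "resolvent A * pencil A = 1\<^sub>m n"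
proof -
  have P: "pencil A \<in> carrier_mat n n" using pencil_carrier[OF A] .
  have "mat_inverse (pencil A) \<noteq> None"
    using mat_inverse(1)[OF P, of undefined]
      det_non_zero_imp_unit[OF P det_pencil[OF A], of undefined] by auto
  then obtain X where X: "mat_inverse (pencil A) = Some X" by auto
  from mat_inverse(2)[OF P X] X
  show "resolvent A \<in> carrier_mat n n"
    and "pencil A * resolvent A = 1\<^sub>m n" and "resolvent A * pencil A = 1\<^sub>m n"
    by (auto simp: resolvent_def)
qed

lemma strictly_proper_diff:
  assumes "strictly_proper f" "strictly_proper g"
  shows "strictly_proper (f - g)"
proof -
  obtain a b where ab: "b \<noteq> 0" "degree a < degree b" "f = Fract a b"
    using assms(1) by (auto simp: strictly_proper_def)
  obtain c d where cd: "d \<noteq> 0" "degree c < degree d" "g = Fract c d"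
    using assms(2) by (auto simp: strictly_proper_def)
  have "f - g = Fract (a * d - c * b) (b * d)" using ab cd by simp
  moreover have "degree (a * d) < degree b + degree d"
    using degree_mult_le[of a d] ab by linarith
  moreover have "degree (c * b) < degree b + degree d"
    using degree_mult_le[of c b] cd by linarith
  moreover have "degree (b * d) = degree b + degree d"
    using ab cd by (simp add: degree_mult_eq)
  ultimately show ?thesis
    unfolding strictly_proper_def using ab cd
    by (intro exI[of _ "a * d - c * b"] exI[of _ "b * d"]) (auto intro!: degree_diff_less)
qed

lemma strictly_proper_polynomial:
  assumes "strictly_proper (to_fract p)"
  shows "p = 0"
proof (rule ccontr)
  assume "p \<noteq> 0"
  obtain a b where ab: "b \<noteq> 0" "degree a < degree b" "to_fract p = Fract a b"
    using assms by (auto simp: strictly_proper_def)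
  then have "p * b = a" by (simp add: to_fract_def eq_fract)
  then have "degree a = degree p + degree b"
    using \<open>p \<noteq> 0\<close> ab by (auto simp: degree_mult_eq)
  then show False using ab by simp
qed

lemma strictly_proper_part_ex1:
  "\<exists>!s. strictly_proper s \<and> f - s \<in> range to_fract"
proof -
  obtain a b where f: "f = Fract a b" "b \<noteq> 0" by (cases f)
  have ex: "\<exists>s. strictly_proper s \<and> f - s \<in> range to_fract"
  proof (cases "degree b = 0")
    case True
    then obtain c where "b = [:c:]" by (metis degree_eq_zeroE)
    then have "f = to_fract (smult (inverse c) a)"
      using f by (auto simp: to_fract_def eq_fract)
    moreover have "strictly_proper 0"
      unfolding strictly_proper_def
      by (intro exI[of _ 0] exI[of _ "[:0, 1:]"]) (auto simp: Zero_fract_def eq_fract)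
    ultimately show ?thesis by (intro exI[of _ 0]) auto
  next
    case False
    have "degree (a mod b) < degree b"
      using False degree_mod_less_degree[of b a] degree_mod_less'[of b a] f
      by (cases "a mod b = 0") auto
    moreover have "f - Fract (a mod b) b = to_fract (a div b)"
    proof -
      have "f - Fract (a mod b) b = Fract (a * b - (a mod b) * b) (b * b)"
        using f by simp
      also have "a * b - (a mod b) * b = (a div b) * (b * b)"
        by (metis left_diff_distrib minus_mod_eq_div_mult mult.assoc)
      also have "Fract ((a div b) * (b * b)) (b * b) = to_fract (a div b)"
        using f by (simp add: to_fract_def eq_fract)
      finally show ?thesis .
    qed
    ultimately show ?thesis
      using f unfolding strictly_proper_def by (intro exI[of _ "Fract (a mod b) b"]) auto
  qed
  moreover have "s = t"
    if s: "strictly_proper s \<and> f - s \<in> range to_fract"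
      and t: "strictly_proper t \<and> f - t \<in> range to_fract" for s t
  proof -
    obtain u where u: "f - s = to_fract u" using s by (auto elim: rangeE)
    obtain v where v: "f - t = to_fract v" using t by (auto elim: rangeE)
    have "s - t = (f - t) - (f - s)" by simp
    also have "\<dots> = to_fract (v - u)" unfolding u v by simp
    finally have st: "s - t = to_fract (v - u)" .
    have "strictly_proper (s - t)" using strictly_proper_diff s t by blast
    then have "v - u = 0" unfolding st by (rule strictly_proper_polynomial)
    then have "s - t = 0" using st by (simp only: to_fract_0)
    then show "s = t" by simp
  qed
  ultimately show ?thesis by (rule ex_ex1I)
qed


lemma strictly_proper_const_mult:
  assumes "strictly_proper f"
  shows "strictly_proper (const_fract c * f)"
proof -
  obtain a b where ab: "b \<noteq> 0" "degree a < degree b" "f = Fract a b"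
    using assms by (auto simp: strictly_proper_def)
  then have "const_fract c * f = Fract (Polynomial.smult c a) b"
    by (simp add: const_fract_def to_fract_def)
  moreover have "degree (Polynomial.smult c a) < degree b"
    using degree_smult_le[of c a] ab(2) by (rule le_less_trans)
  ultimately show ?thesis
    unfolding strictly_proper_def using ab by blast
qed

lemma strictly_proper_0: "strictly_proper 0"
  unfolding strictly_proper_def
  by (intro exI[of _ 0] exI[of _ "[:0, 1:]"]) (auto simp: Zero_fract_def eq_fract)

lemma strictly_proper_add:
  assumes "strictly_proper f" "strictly_proper g"
  shows "strictly_proper (f + g)"
  using strictly_proper_diff[OF assms(1) strictly_proper_diff[OF strictly_proper_0 assms(2)]]
  by simp

lemma const_fract_simps [simp]:
  "const_fract (a + b) = const_fract a + const_fract b"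
  "const_fract (a * b) = const_fract a * const_fract b"
  "const_fract 1 = 1" "const_fract 0 = 0"
  by (simp_all add: const_fract_def flip: to_fract_add to_fract_mult to_fract_1 one_pCons)

lemma vectorspace_rational_vecs: "vectorspace class_ring (rational_vecs q)"
proof -
  have "abelian_group (rational_vecs q)"
  proof (rule abelian_groupI)
    fix x assume "x \<in> carrier (rational_vecs q)"
    then show "\<exists>y\<in>carrier (rational_vecs q).
        y \<oplus>\<^bsub>rational_vecs q\<^esub> x = \<zero>\<^bsub>rational_vecs q\<^esub>"
      by (intro bexI[of _ "- x"]) (auto simp: rational_vecs_def)
  qed (auto simp: rational_vecs_def intro: comm_add_vec)
  then have "Module.module (class_ring :: complex ring) (rational_vecs q)"
    by (intro moduleI fieldE(1) class_field)
      (auto simp: rational_vecs_def add_smult_distrib_vec smult_add_distrib_vec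
        smult_smult_assoc)
  then show ?thesis by (simp add: vectorspace_def class_field)
qed

lemma quotient_space_vectorspace:
  assumes M: "vectorspace K M" and V: "submodule K V M" and W: "submodule K W M"
    and WV: "W \<subseteq> V"
  shows "vectorspace K (quotient_space M V W)"
proof -
  interpret M: vectorspace K M by (rule M)
  interpret V: submodule K V M by (rule V)
  interpret W: submodule K W M by (rule W)
  have K: "cring K" "field K" using M by (simp_all add: vectorspace_def Module.module_def)
  have KR: "ring K" by (rule cring.axioms(1)[OF K(1)])
  note K_monoid = ring.is_monoid[OF KR] and K_group = ring.is_abelian_group[OF KR]
  have neg: "\<ominus>\<^bsub>M\<^esub> x \<in> N" if N: "submodule K N M" and x: "x \<in> N" for N x
  proof -
    have xM: "x \<in> carrier M" using x submodule.subset[OF N] by blast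
    have one: "\<one>\<^bsub>K\<^esub> \<in> carrier K" by (rule monoid.one_closed[OF K_monoid])
    have "(\<ominus>\<^bsub>K\<^esub> \<one>\<^bsub>K\<^esub>) \<odot>\<^bsub>M\<^esub> x = \<ominus>\<^bsub>M\<^esub> x"
      unfolding M.module.smult_l_minus[OF one xM] M.module.smult_one[OF xM] ..
    then show ?thesis
      using submodule.smult_closed[OF N abelian_group.a_inv_closed[OF K_group one] x] by metis
  qed
  have "subgroup W (add_monoid M)"
  proof (rule subgroup.intro)
    show "W \<subseteq> carrier (add_monoid M)" using W.subset by simp
    show "\<one>\<^bsub>add_monoid M\<^esub> \<in> W" using W.zero_closed by simp
    show "x \<otimes>\<^bsub>add_monoid M\<^esub> y \<in> W" if "x \<in> W" "y \<in> W" for x y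
      using W.m_closed[OF that] by simp
    show "inv\<^bsub>add_monoid M\<^esub> x \<in> W" if "x \<in> W" for x
      using neg[OF W that] unfolding a_inv_def .
  qed
  then interpret S: abelian_subgroup W M
    by (intro abelian_subgroupI3 additive_subgroup.intro M.abelian_group_axioms)
  have VM: "x \<in> carrier M" if "x \<in> V" for x using that V.subset by blast
  have add: "(W +>\<^bsub>M\<^esub> x) <+>\<^bsub>M\<^esub> (W +>\<^bsub>M\<^esub> y) = W +>\<^bsub>M\<^esub> (x \<oplus>\<^bsub>M\<^esub> y)"
    if "x \<in> V" "y \<in> V" for x y
    using S.a_rcos_sum that VM by blast
  have smult: "(\<Union>y\<in>W +>\<^bsub>M\<^esub> x. W +>\<^bsub>M\<^esub> (c \<odot>\<^bsub>M\<^esub> y)) = W +>\<^bsub>M\<^esub> (c \<odot>\<^bsub>M\<^esub> x)"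
    if "x \<in> V" "c \<in> carrier K" for x c
  proof -
    have "W +>\<^bsub>M\<^esub> (c \<odot>\<^bsub>M\<^esub> y) = W +>\<^bsub>M\<^esub> (c \<odot>\<^bsub>M\<^esub> x)" if y: "y \<in> W +>\<^bsub>M\<^esub> x" for y
    proof -
      obtain w where w: "w \<in> W" "y = w \<oplus>\<^bsub>M\<^esub> x" using y by (auto simp: a_r_coset_def')
      have "w \<in> carrier M" using w W.subset by blast
      then have "c \<odot>\<^bsub>M\<^esub> y = c \<odot>\<^bsub>M\<^esub> w \<oplus>\<^bsub>M\<^esub> c \<odot>\<^bsub>M\<^esub> x"
        using w VM[OF \<open>x \<in> V\<close>] \<open>c \<in> carrier K\<close> by (simp add: M.module.smult_r_distr)
      then have "c \<odot>\<^bsub>M\<^esub> y \<in> W +>\<^bsub>M\<^esub> (c \<odot>\<^bsub>M\<^esub> x)"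
        using w \<open>c \<in> carrier K\<close> by (auto simp: a_r_coset_def')
      then show ?thesis
        using S.a_repr_independence' VM[OF \<open>x \<in> V\<close>] \<open>c \<in> carrier K\<close> by simp
    qed
    moreover have "x \<in> W +>\<^bsub>M\<^esub> x" using S.a_rcos_self VM[OF \<open>x \<in> V\<close>] by simp
    ultimately show ?thesis by blast
  qed
  have zero: "W = W +>\<^bsub>M\<^esub> \<zero>\<^bsub>M\<^esub>"
    using S.a_subset by (simp add: M.a_coset_add_zero)
  let ?Q = "quotient_space M V W"
  have Q: "carrier ?Q = a_r_coset M W ` V" "add ?Q = set_add M" "zero ?Q = W"
    "module.smult ?Q = (\<lambda>c X. \<Union>x\<in>X. a_r_coset M W (module.smult M c x))"
    by (simp_all add: quotient_space_def)
  have qsmult: "c \<odot>\<^bsub>?Q\<^esub> (W +>\<^bsub>M\<^esub> x) = W +>\<^bsub>M\<^esub> (c \<odot>\<^bsub>M\<^esub> x)"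
    if "x \<in> V" "c \<in> carrier K" for x c
    unfolding Q(4) using that by (rule smult)
  have zz: "zero ?Q = W +>\<^bsub>M\<^esub> \<zero>\<^bsub>M\<^esub>" using zero Q by simp
  have rep: "\<exists>x\<in>V. X = W +>\<^bsub>M\<^esub> x" if "X \<in> carrier ?Q" for X
    using that by (auto simp: Q(1))
  have Qadd: "(W +>\<^bsub>M\<^esub> x) \<oplus>\<^bsub>?Q\<^esub> (W +>\<^bsub>M\<^esub> y) = W +>\<^bsub>M\<^esub> (x \<oplus>\<^bsub>M\<^esub> y)"
    if "x \<in> V" "y \<in> V" for x y
    unfolding Q(2) using that by (rule add)
  have "abelian_group ?Q"
  proof (rule abelian_groupI)
    show "\<zero>\<^bsub>?Q\<^esub> \<in> carrier ?Q"
      unfolding zz Q(1) using V.zero_closed by blast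
    fix X assume X: "X \<in> carrier ?Q"
    obtain x where x: "x \<in> V" "X = W +>\<^bsub>M\<^esub> x" using rep[OF X] by blast
    show "\<zero>\<^bsub>?Q\<^esub> \<oplus>\<^bsub>?Q\<^esub> X = X"
      unfolding x(2) zz Qadd[OF V.zero_closed x(1)] M.l_zero[OF VM[OF x(1)]] ..
    have "(W +>\<^bsub>M\<^esub> (\<ominus>\<^bsub>M\<^esub> x)) \<oplus>\<^bsub>?Q\<^esub> X = \<zero>\<^bsub>?Q\<^esub>"
      unfolding x(2) zz Qadd[OF neg[OF V x(1)] x(1)] M.l_neg[OF VM[OF x(1)]] ..
    moreover have "W +>\<^bsub>M\<^esub> (\<ominus>\<^bsub>M\<^esub> x) \<in> carrier ?Q"
      unfolding Q(1) using neg[OF V x(1)] by blast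
    ultimately show "\<exists>Y\<in>carrier ?Q. Y \<oplus>\<^bsub>?Q\<^esub> X = \<zero>\<^bsub>?Q\<^esub>" by blast
    fix Y assume Y: "Y \<in> carrier ?Q"
    obtain y where y: "y \<in> V" "Y = W +>\<^bsub>M\<^esub> y" using rep[OF Y] by blast
    show "X \<oplus>\<^bsub>?Q\<^esub> Y \<in> carrier ?Q"
      unfolding x(2) y(2) Qadd[OF x(1) y(1)] Q(1) using V.m_closed[OF x(1) y(1)] by blast
    show "X \<oplus>\<^bsub>?Q\<^esub> Y = Y \<oplus>\<^bsub>?Q\<^esub> X"
      unfolding x(2) y(2) Qadd[OF x(1) y(1)] Qadd[OF y(1) x(1)]
        M.a_comm[OF VM[OF x(1)] VM[OF y(1)]] ..
    fix Z assume Z: "Z \<in> carrier ?Q"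
    obtain z where z: "z \<in> V" "Z = W +>\<^bsub>M\<^esub> z" using rep[OF Z] by blast
    show "(X \<oplus>\<^bsub>?Q\<^esub> Y) \<oplus>\<^bsub>?Q\<^esub> Z = X \<oplus>\<^bsub>?Q\<^esub> (Y \<oplus>\<^bsub>?Q\<^esub> Z)"
      unfolding x(2) y(2) z(2) Qadd[OF x(1) y(1)] Qadd[OF y(1) z(1)]
        Qadd[OF V.m_closed[OF x(1) y(1)] z(1)] Qadd[OF x(1) V.m_closed[OF y(1) z(1)]]
        M.a_assoc[OF VM[OF x(1)] VM[OF y(1)] VM[OF z(1)]] ..
  qed
  then have "Module.module K ?Q"
  proof (rule moduleI[OF K(1)])
    fix a b X Y
    assume X: "X \<in> carrier ?Q"
    obtain x where x: "x \<in> V" "X = W +>\<^bsub>M\<^esub> x" using rep[OF X] by blast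
    note xM = VM[OF x(1)]
    show "\<one>\<^bsub>K\<^esub> \<odot>\<^bsub>?Q\<^esub> X = X"
      unfolding x(2) qsmult[OF x(1) monoid.one_closed[OF K_monoid]] M.module.smult_one[OF xM] ..
    assume a: "a \<in> carrier K"
    show "a \<odot>\<^bsub>?Q\<^esub> X \<in> carrier ?Q"
      unfolding x(2) qsmult[OF x(1) a] Q(1) using V.smult_closed[OF a x(1)] by blast
    {
      assume Y: "Y \<in> carrier ?Q"
      obtain y where y: "y \<in> V" "Y = W +>\<^bsub>M\<^esub> y" using rep[OF Y] by blast
      show "a \<odot>\<^bsub>?Q\<^esub> (X \<oplus>\<^bsub>?Q\<^esub> Y) = a \<odot>\<^bsub>?Q\<^esub> X \<oplus>\<^bsub>?Q\<^esub> a \<odot>\<^bsub>?Q\<^esub> Y"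
        unfolding x(2) y(2) Q(2) qsmult[OF x(1) a] qsmult[OF y(1) a] add[OF x(1) y(1)]
          qsmult[OF V.m_closed[OF x(1) y(1)] a]
          add[OF V.smult_closed[OF a x(1)] V.smult_closed[OF a y(1)]]
          M.module.smult_r_distr[OF a xM VM[OF y(1)]] ..
    }
    assume b: "b \<in> carrier K"
    show "(a \<oplus>\<^bsub>K\<^esub> b) \<odot>\<^bsub>?Q\<^esub> X = a \<odot>\<^bsub>?Q\<^esub> X \<oplus>\<^bsub>?Q\<^esub> b \<odot>\<^bsub>?Q\<^esub> X"
      unfolding x(2) Q(2) qsmult[OF x(1) a] qsmult[OF x(1) b] qsmult[OF x(1) abelian_monoid.a_closed[OF abelian_group.axioms(1)[OF K_group] a b]]
        add[OF V.smult_closed[OF a x(1)] V.smult_closed[OF b x(1)]]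
        M.module.smult_l_distr[OF a b xM] ..
    show "(a \<otimes>\<^bsub>K\<^esub> b) \<odot>\<^bsub>?Q\<^esub> X = a \<odot>\<^bsub>?Q\<^esub> (b \<odot>\<^bsub>?Q\<^esub> X)"
      unfolding x(2) qsmult[OF x(1) b] qsmult[OF V.smult_closed[OF b x(1)] a]
        qsmult[OF x(1) monoid.m_closed[OF K_monoid a b]] M.module.smult_assoc1[OF a b xM] ..
  qed
  then show ?thesis by (simp add: vectorspace_def K(2))
qed


lemma submodule_rational_vecsI:
  assumes "S \<subseteq> carrier_vec q" "0\<^sub>v q \<in> S"
    and "\<And>v w. v \<in> S \<Longrightarrow> w \<in> S \<Longrightarrow> v + w \<in> S"
    and "\<And>c v. v \<in> S \<Longrightarrow> const_fract c \<cdot>\<^sub>v v \<in> S"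
  shows "submodule class_ring S (rational_vecs q)"
proof (rule submodule.intro)
  show "Module.module class_ring (rational_vecs q)"
    using vectorspace_rational_vecs[of q] unfolding vectorspace_def by (rule conjunct1)
qed (use assms in \<open>simp_all add: rational_vecs_def\<close>)

lemma submodule_rational_vecsD:
  assumes "submodule class_ring S (rational_vecs q)"
  shows "0\<^sub>v q \<in> S"
    and "v \<in> S \<Longrightarrow> w \<in> S \<Longrightarrow> v + w \<in> S"
    and "v \<in> S \<Longrightarrow> const_fract c \<cdot>\<^sub>v v \<in> S"
  using submodule.zero_closed[OF assms] submodule.m_closed[OF assms, of v w]
    submodule.smult_closed[OF assms, of c v]
  by (simp_all add: rational_vecs_def)

lemma submodule_componentwise:
  assumes "0 \<in> P" "\<And>x y. x \<in> P \<Longrightarrow> y \<in> P \<Longrightarrow> x + y \<in> P"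
    and "\<And>c x. x \<in> P \<Longrightarrow> const_fract c * x \<in> P"
  shows "submodule class_ring {v \<in> carrier_vec q. \<forall>i<q. v $ i \<in> P} (rational_vecs q)"
proof (rule submodule_rational_vecsI)
  show "0\<^sub>v q \<in> {v \<in> carrier_vec q. \<forall>i<q. v $ i \<in> P}"
    using assms(1) by simp
  show "v + w \<in> {v \<in> carrier_vec q. \<forall>i<q. v $ i \<in> P}"
    if "v \<in> {v \<in> carrier_vec q. \<forall>i<q. v $ i \<in> P}"
       "w \<in> {v \<in> carrier_vec q. \<forall>i<q. v $ i \<in> P}" for v w
    using that assms(2) by auto
  show "const_fract c \<cdot>\<^sub>v v \<in> {v \<in> carrier_vec q. \<forall>i<q. v $ i \<in> P}"
    if "v \<in> {v \<in> carrier_vec q. \<forall>i<q. v $ i \<in> P}" for c v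
    using that assms(3) by auto
qed blast

lemma submodule_strictly_proper_vecs:
  "submodule class_ring (strictly_proper_vecs q) (rational_vecs q)"
  using submodule_componentwise[of "Collect strictly_proper" q]
  by (simp add: strictly_proper_vecs_def strictly_proper_0 strictly_proper_add
      strictly_proper_const_mult)

lemma range_to_fract_closed:
  "0 \<in> range to_fract"
  "x \<in> range to_fract \<Longrightarrow> y \<in> range to_fract \<Longrightarrow> x + y \<in> range to_fract"
  "x \<in> range to_fract \<Longrightarrow> const_fract c * x \<in> range to_fract"
proof -
  show "0 \<in> range to_fract" using rangeI[of to_fract 0] unfolding to_fract_0 .
  show "x + y \<in> range to_fract" if x: "x \<in> range to_fract" and y: "y \<in> range to_fract"
  proof -
    obtain a where a: "x = to_fract a" using x by (rule rangeE)
    obtain b where b: "y = to_fract b" using y by (rule rangeE)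
    show ?thesis unfolding a b to_fract_add[symmetric] by (rule rangeI)
  qed
  show "const_fract c * x \<in> range to_fract" if x: "x \<in> range to_fract"
  proof -
    obtain a where a: "x = to_fract a" using x by (rule rangeE)
    show ?thesis unfolding a const_fract_def to_fract_mult[symmetric] by (rule rangeI)
  qed
qed

lemma submodule_polynomial_vecs:
  "submodule class_ring (polynomial_vecs q) (rational_vecs q)"
  unfolding polynomial_vecs_def
  by (rule submodule_componentwise) (rule range_to_fract_closed; assumption)+

lemma submodule_preimage:
  assumes F: "F \<in> carrier_mat p q" and S: "submodule class_ring S (rational_vecs p)"
  shows "submodule class_ring {g \<in> carrier_vec q. F *\<^sub>v g \<in> S} (rational_vecs q)"
proof (rule submodule_rational_vecsI)
  have "F *\<^sub>v 0\<^sub>v q = 0\<^sub>v p" using F by (intro eq_vecI) auto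
  then show "0\<^sub>v q \<in> {g \<in> carrier_vec q. F *\<^sub>v g \<in> S}"
    using submodule_rational_vecsD(1)[OF S] by simp
  show "v + w \<in> {g \<in> carrier_vec q. F *\<^sub>v g \<in> S}"
    if "v \<in> {g \<in> carrier_vec q. F *\<^sub>v g \<in> S}" "w \<in> {g \<in> carrier_vec q. F *\<^sub>v g \<in> S}" for v w
    using that submodule_rational_vecsD(2)[OF S] by (simp add: mult_add_distrib_mat_vec[OF F])
  show "const_fract c \<cdot>\<^sub>v v \<in> {g \<in> carrier_vec q. F *\<^sub>v g \<in> S}"
    if "v \<in> {g \<in> carrier_vec q. F *\<^sub>v g \<in> S}" for c v
    using that submodule_rational_vecsD(3)[OF S] by (simp add: mult_mat_vec[OF F])
qed blast

lemma submodule_inverse_image_poly: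
  "submodule class_ring (inverse_image_poly F) (rational_vecs (dim_col F))"
  unfolding inverse_image_poly_def
  by (rule submodule_preimage[OF _ submodule_polynomial_vecs]) simp

lemma submodule_mat_kernel:
  fixes F :: "ratfun mat"
  shows "submodule class_ring (mat_kernel F) (rational_vecs (dim_col F))"
proof -
  have "submodule class_ring {0\<^sub>v (dim_row F)} (rational_vecs (dim_row F))"
    by (rule submodule_rational_vecsI) (simp_all add: vec_eq_iff)
  moreover have "F \<in> carrier_mat (dim_row F) (dim_col F)" by simp
  ultimately have "submodule class_ring
      {g \<in> carrier_vec (dim_col F). F *\<^sub>v g \<in> {0\<^sub>v (dim_row F)}} (rational_vecs (dim_col F))"
    by (rule submodule_preimage[rotated])
  then show ?thesis unfolding mat_kernel_def singleton_iff .
qed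

lemma submodule_inter:
  assumes "submodule K S M" "submodule K T M"
  shows "submodule K (S \<inter> T) M"
  using assms unfolding submodule_def by blast

lemma vectorspace_fzk_space: "vectorspace class_ring (fzk_space F)"
  unfolding fzk_space_def
proof (rule quotient_space_vectorspace[OF vectorspace_rational_vecs])
  let ?M = "rational_vecs (dim_col F)"
  interpret M: vectorspace class_ring ?M by (rule vectorspace_rational_vecs)
  have sum: "set_add ?M S T = M.submodule_sum S T" for S T
    unfolding set_add_def' M.submodule_sum_def by fast
  show "submodule class_ring (fzk_numerator F) ?M"
    unfolding fzk_numerator_def sum
    by (intro submodule_inter M.sum_is_submodule submodule_strictly_proper_vecs
        submodule_inverse_image_poly submodule_polynomial_vecs)
  show "submodule class_ring (strictly_proper_kernel F) ?M"
    unfolding strictly_proper_kernel_def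
    by (intro submodule_inter submodule_mat_kernel submodule_strictly_proper_vecs)
  show "strictly_proper_kernel F \<subseteq> fzk_numerator F"
  proof
    fix g assume g: "g \<in> strictly_proper_kernel F"
    then have gF: "g \<in> carrier_vec (dim_col F)" "F *\<^sub>v g = 0\<^sub>v (dim_row F)"
      and gs: "g \<in> strictly_proper_vecs (dim_col F)"
      by (auto simp: strictly_proper_kernel_def mat_kernel_def)
    have zero: "0\<^sub>v k \<in> polynomial_vecs k" for k
      by (simp add: polynomial_vecs_def range_to_fract_closed)
    have "g \<in> inverse_image_poly F"
      unfolding inverse_image_poly_def using gF zero by simp
    moreover have "g = g \<oplus>\<^bsub>?M\<^esub> 0\<^sub>v (dim_col F)"
      using gF(1) by (simp add: rational_vecs_def)
    ultimately have "g \<in> set_add ?M (inverse_image_poly F) (polynomial_vecs (dim_col F))"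
      unfolding set_add_def' using zero[of "dim_col F"] by blast
    then show "g \<in> fzk_numerator F" unfolding fzk_numerator_def using gs by blast
  qed
qed

end

theory Submission
  imports Defs
begin

text \<open>
  Write \<open>G(z) = H(zI - \<Lambda>)\<^sup>-\<^sup>1\<close> and \<open>P\<close> for the given solution, so that \<open>AP + BH = P\<Lambda>\<close> and
  \<open>CP + DH = 0\<close>.  These two equations say that \<open>P(zI - \<Lambda>)\<^sup>-\<^sup>1\<beta>\<close> is a state trajectory which the
  input \<open>G\<beta>\<close> drives with output zero, up to the initial condition \<open>P\<beta>\<close>.  Hence applying \<open>F\<close> to
  \<open>G\<beta> + u\<close> only sees \<open>u\<close> and that initial condition (lemma \<open>F_mult_G_plus\<close>):
  \<open>F(G\<beta> + u) = Du + Ce\<close>, where \<open>(zI - A)e = Bu - P\<beta>\<close>.  For a constant \<open>u = r\<close> the vector \<open>e\<close> is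
  strictly proper, and observability turns \<open>F(G\<beta> + r) = 0\<close> into \<open>Br = P\<beta>\<close>, \<open>Dr = 0\<close>: pairs
  \<open>(r, \<beta>)\<close> solving the equation for \<open>(R\<^sub>0, \<alpha>\<^sub>0)\<close> are exactly the kernel elements of the form
  \<open>G\<beta> + r\<close> (lemmas \<open>zero_state_imp_kernel\<close>, \<open>kernel_imp_zero_state\<close>).  Since \<open>P\<close> is injective,
  maximality says that all such \<open>\<beta>\<close> form \<open>Im \<alpha>\<^sub>0\<close> (lemma \<open>maximal_solution_image\<close>).

  The basis property says that every strictly proper \<open>g\<close> with \<open>g + u \<in> ker F\<close>, \<open>u\<close> polynomial, is
  \<open>G\<beta>\<close> modulo \<open>ker F \<inter> z\<^sup>-\<^sup>1\<Omega>\<^sub>\<infinity>U\<close> for one vector \<open>\<beta>\<close>.  So the theorem is the equality of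
  \<open>\<langle>\<Lambda> | \<alpha>\<^sub>0\<rangle>\<close> with the set of all \<open>\<beta>\<close> for which \<open>G\<beta> + u \<in> ker F\<close> for some polynomial \<open>u\<close>.

  The kernel is closed under multiplication by \<open>z\<close>, and \<open>zG\<beta> = G\<Lambda>\<beta> + H\<beta>\<close>; therefore this set is a
  \<open>\<Lambda>\<close>-invariant subspace, and it contains \<open>Im \<alpha>\<^sub>0\<close> (lemma \<open>reachable_imp_kernel\<close>).  The kernel is
  also closed under division by \<open>z\<close>.  Given \<open>k = G\<beta> + u \<in> ker F\<close> with \<open>u = u\<^sub>0 + zu'\<close>, the strictly proper
  part of \<open>k/z\<close> is some \<open>G\<beta>'\<close> plus a strictly proper kernel element \<open>k\<^sub>0\<close>, and \<open>k/z\<close> has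
  polynomial part \<open>u'\<close> of smaller degree.  Multiplying back by \<open>z\<close> gives
  \<open>zk\<^sub>0 = G(\<beta> - \<Lambda>\<beta>') + (u\<^sub>0 - H\<beta>')\<close>, a kernel element with constant polynomial part, hence
  \<open>\<beta> - \<Lambda>\<beta>' \<in> Im \<alpha>\<^sub>0\<close>.  Induction on the degree of \<open>u\<close> ends at \<open>u = 0\<close>, where \<open>\<beta> = 0\<close> by
  linear independence (lemma \<open>kernel_imp_reachable\<close>).
\<close>

section \<open>Strictly proper rational functions\<close>

interpretation const_fract: inj_comm_ring_hom const_fract
  by unfold_locales (simp_all, simp add: const_fract_def)

lemma const_fract_minus [simp]: "const_fract (- a) = - const_fract a"
  "const_fract (a - b) = const_fract a - const_fract b"
  by (simp_all add: const_fract.hom_uminus const_fract.hom_minus)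

lemma strictly_proper_const_fract:
  assumes "strictly_proper (const_fract c)"
  shows "c = 0"
  using strictly_proper_polynomial[of "[:c:]"] assms by (simp add: const_fract_def)

lemma strictly_proper_uminus: "strictly_proper f \<Longrightarrow> strictly_proper (- f)"
  using strictly_proper_diff[OF strictly_proper_0] by force

lemma strictly_proper_sum:
  "(\<And>i. i \<in> S \<Longrightarrow> strictly_proper (f i)) \<Longrightarrow> strictly_proper (sum f S)"
  by (induction S rule: infinite_finite_induct) (auto intro: strictly_proper_0 strictly_proper_add)

lemma z_fract_nonzero [simp]: "z_fract \<noteq> 0"
  by (simp add: z_fract_def)

lemma strictly_proper_part_eqI:
  assumes "strictly_proper s" "f - s = to_fract p"
  shows "strictly_proper_part f = s"
  unfolding strictly_proper_part_def
  using strictly_proper_part_ex1[of f] assms by (intro the1_equality) auto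

lemma strictly_proper_part:
  "strictly_proper (strictly_proper_part f)"
  "f - strictly_proper_part f \<in> range to_fract"
  using theI'[OF strictly_proper_part_ex1[of f]] unfolding strictly_proper_part_def by auto

text \<open>
  Multiplication by \<open>z\<close> raises the degree of the numerator by one, so all that can appear in the
  polynomial part is the constant quotient of the two leading terms.
\<close>

lemma z_fract_mult_strictly_proper:
  assumes "strictly_proper f"
  shows "\<exists>c. strictly_proper (z_fract * f - const_fract c)"
proof -
  obtain a b where ab: "b \<noteq> 0" "degree a < degree b" "f = Fract a b"
    using assms by (auto simp: strictly_proper_def)
  \<comment> \<open>The limit of \<open>z a(z) / b(z)\<close> at infinity; it vanishes unless \<open>degree a = degree b - 1\<close>.\<close>
  define c where "c = coeff a (degree b - 1) / lead_coeff b"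
  have eq: "z_fract * f - const_fract c = Fract (pCons 0 a - Polynomial.smult c b) b"
  proof -
    have "z_fract * f = Fract (pCons 0 a) b"
      using ab by (simp add: z_fract_def to_fract_def)
    moreover have "const_fract c = Fract (Polynomial.smult c b) b"
      using ab by (simp add: const_fract_def to_fract_def eq_fract)
    moreover have "Fract x b - Fract y b = Fract (x - y) b" for x y
      using ab by (simp add: eq_fract algebra_simps)
    ultimately show ?thesis by simp
  qed
  have "degree (pCons 0 a - Polynomial.smult c b) < degree b"
  proof -
    have le: "degree (pCons 0 a - Polynomial.smult c b) \<le> degree b"
      using ab by (intro degree_diff_le) (auto simp: degree_pCons_le[THEN order_trans])
    have "coeff (pCons 0 a - Polynomial.smult c b) (degree b) = 0"
      using ab leading_coeff_neq_0[OF ab(1)] by (cases "degree b") (simp_all add: c_def)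
    then show ?thesis
      using le ab(2)
      by (cases "degree (pCons 0 a - Polynomial.smult c b) = degree b")
        (metis gr_implies_not0 degree_0 leading_coeff_0_iff, linarith)
  qed
  then show ?thesis using ab(1) unfolding strictly_proper_def by (metis eq)
qed

lemma strictly_proper_divide_z_fract:
  assumes "strictly_proper f"
  shows "strictly_proper (f / z_fract)"
proof -
  obtain a b where ab: "b \<noteq> 0" "degree a < degree b" "f = Fract a b"
    using assms by (auto simp: strictly_proper_def)
  have "f / z_fract = Fract a (pCons 0 b)"
    using ab by (simp add: z_fract_def to_fract_def)
  moreover have "degree a < degree (pCons 0 b)" using ab by simp
  ultimately show ?thesis
    unfolding strictly_proper_def using ab(1)
    by (intro exI[of _ a] exI[of _ "pCons 0 b"]) simp
qed

lemma strictly_proper_const_fract_divide_z_fract: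
  "strictly_proper (const_fract c / z_fract)"
proof -
  have "const_fract c / z_fract = Fract [:c:] [:0, 1:]"
    by (simp add: z_fract_def const_fract_def to_fract_def)
  then show ?thesis
    unfolding strictly_proper_def by (intro exI[of _ "[:c:]"] exI[of _ "[:0, 1:]"]) simp
qed

lemma to_fract_pCons: "to_fract (pCons a p) = const_fract a + z_fract * to_fract p"
  unfolding const_fract_def z_fract_def to_fract_mult[symmetric] to_fract_add[symmetric]
  by simp

section \<open>State equations and observability\<close>

lemma strictly_proper_vecs_carrier: "v \<in> strictly_proper_vecs q \<Longrightarrow> v \<in> carrier_vec q"
  by (simp add: strictly_proper_vecs_def)

lemma ratmat_mult_strictly_proper:
  assumes "M \<in> carrier_mat r n" "y \<in> strictly_proper_vecs n"
  shows "ratmat M *\<^sub>v y \<in> strictly_proper_vecs r"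
  using assms unfolding strictly_proper_vecs_def
  by (auto simp: scalar_prod_def intro!: strictly_proper_sum strictly_proper_const_mult)

lemma strictly_proper_plus_constant_eq_0:
  assumes v: "v \<in> strictly_proper_vecs r" and d: "d \<in> carrier_vec r"
    and eq: "v + ratvec d = 0\<^sub>v r"
  shows "d = 0\<^sub>v r" and "v = 0\<^sub>v r"
proof -
  have vd: "v $ i = - const_fract (d $ i)" if "i < r" for i
    using arg_cong[OF eq, of "\<lambda>w. w $ i"] that v d
    by (auto simp: strictly_proper_vecs_def eq_neg_iff_add_eq_0)
  have "d $ i = 0" if "i < r" for i
    using strictly_proper_uminus[of "v $ i"] v vd[OF that] that
    by (intro strictly_proper_const_fract) (auto simp: strictly_proper_vecs_def)
  then show "d = 0\<^sub>v r" "v = 0\<^sub>v r" using v d vd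
    by (auto simp: strictly_proper_vecs_def)
qed

lemma pencil_mult_vec:
  assumes A: "A \<in> carrier_mat n n" and y: "y \<in> carrier_vec n"
  shows "pencil A *\<^sub>v y = z_fract \<cdot>\<^sub>v y - ratmat A *\<^sub>v y"
proof -
  have "pencil A *\<^sub>v y = (z_fract \<cdot>\<^sub>m 1\<^sub>m n) *\<^sub>v y - ratmat A *\<^sub>v y"
    using A y by (simp add: pencil_def minus_mult_distrib_mat_vec[of _ n n])
  also have "(z_fract \<cdot>\<^sub>m 1\<^sub>m n) *\<^sub>v y = z_fract \<cdot>\<^sub>v y"
    using y by (intro eq_vecI) (simp_all add: scalar_prod_def if_distrib if_distribR cong: if_cong)
  finally show ?thesis .
qed

text \<open>
  This is the fact that the resolvent is strictly proper.  The polynomial part \<open>p\<close> of \<open>y\<close> satisfies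
  \<open>z p = A p + const\<close>, because the remaining terms are strictly proper and polynomial at once.
  Comparing coefficients, each coefficient of \<open>p\<close> is a combination of coefficients of the next
  higher power, and those of large powers vanish.
\<close>

lemma pencil_solution_strictly_proper:
  assumes A: "A \<in> carrier_mat n n" and y: "y \<in> carrier_vec n" and x: "x \<in> carrier_vec n"
    and eq: "pencil A *\<^sub>v y = ratvec x"
  shows "y \<in> strictly_proper_vecs n"
proof -
  define s where "s j = strictly_proper_part (y $ j)" for j
  have sp: "strictly_proper (s j)" for j
    unfolding s_def by (rule strictly_proper_part)
  have "\<exists>p. y $ j - s j = to_fract p" for j
    using strictly_proper_part(2)[of "y $ j"] unfolding s_def by blast
  then obtain p where p: "\<And>j. y $ j - s j = to_fract (p j)" by metis
  obtain c where c: "\<And>j. strictly_proper (z_fract * s j - const_fract (c j))"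
    using z_fract_mult_strictly_proper[OF sp] by metis
  \<comment> \<open>The \<open>j\<close>-th component of \<open>z p - A p - const\<close>.\<close>
  define e where
    "e j = pCons (c j - x $ j) (p j) - (\<Sum>k<n. Polynomial.smult (A $$ (j, k)) (p k))" for j
  have "e j = 0" if j: "j < n" for j
  proof (rule strictly_proper_polynomial)
    have "z_fract * y $ j - (\<Sum>k<n. const_fract (A $$ (j, k)) * y $ k) = const_fract (x $ j)"
      using arg_cong[OF eq, of "\<lambda>v. v $ j"] j A x y
      by (simp add: pencil_mult_vec scalar_prod_def atLeast0LessThan)
    moreover have "y $ k = s k + to_fract (p k)" for k
      using p[of k] by (simp add: algebra_simps)
    ultimately have "z_fract * s j + z_fract * to_fract (p j)
        - ((\<Sum>k<n. const_fract (A $$ (j, k)) * s k)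
           + (\<Sum>k<n. const_fract (A $$ (j, k)) * to_fract (p k))) = const_fract (x $ j)"
      by (simp only: distrib_left sum.distrib)
    moreover have "to_fract (e j) = const_fract (c j) - const_fract (x $ j) + z_fract * to_fract (p j)
        - (\<Sum>k<n. const_fract (A $$ (j, k)) * to_fract (p k))"
    proof -
      have "to_fract (Polynomial.smult a r) = const_fract a * to_fract r" for a r
        by (simp add: const_fract_def flip: to_fract_mult)
      then show ?thesis
        unfolding e_def to_fract_diff to_fract_pCons to_fract_sum by simp
    qed
    moreover have "c' - x' + f - t = u - (g - c')" if "g + f - (u + t) = x'" for c' x' f t u g :: ratfun
      using that by (auto simp: algebra_simps)
    ultimately have "to_fract (e j) = (\<Sum>k<n. const_fract (A $$ (j, k)) * s k)
        - (z_fract * s j - const_fract (c j))"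
      by simp
    then show "strictly_proper (to_fract (e j))"
      by (simp only:) (intro strictly_proper_diff[OF _ c] strictly_proper_sum strictly_proper_const_mult sp)
  qed
  then have step: "coeff (p j) i = (\<Sum>k<n. A $$ (j, k) * coeff (p k) (Suc i))" if "j < n" for i j
  proof -
    have "coeff (e j) (Suc i) = 0" using that \<open>\<And>j. j < n \<Longrightarrow> e j = 0\<close> by simp
    then show ?thesis by (simp add: e_def coeff_sum)
  qed
  define N where "N = Suc (\<Sum>k<n. degree (p k))"
  have "\<forall>j<n. \<forall>i. N \<le> i + t \<longrightarrow> coeff (p j) i = 0" for t
  proof (induction t)
    case 0
    show ?case
    proof (intro allI impI)
      fix j i assume "j < n" "N \<le> i + 0"
      moreover have "degree (p j) < N"
        using member_le_sum[of j "{..<n}" "\<lambda>k. degree (p k)"] \<open>j < n\<close> by (simp add: N_def)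
      ultimately show "coeff (p j) i = 0" by (intro coeff_eq_0) simp
    qed
  next
    case (Suc t)
    show ?case
    proof (intro allI impI)
      fix j i assume "j < n" "N \<le> i + Suc t"
      then show "coeff (p j) i = 0" using Suc by (subst step) auto
    qed
  qed
  from this[of N] have "p j = 0" if "j < n" for j
    using that by (intro poly_eqI) auto
  then have "y $ j = s j" if "j < n" for j
    using p[of j] that by simp
  then show ?thesis using y sp by (simp add: strictly_proper_vecs_def)
qed

text \<open>
  Here \<open>y = (zI - A)\<^sup>-\<^sup>1x\<close>, so the hypothesis reads \<open>d + C(zI - A)\<^sup>-\<^sup>1x = 0\<close>.  The second summand is
  strictly proper and \<open>d\<close> is constant, so both vanish.  If \<open>My = 0\<close> for a constant matrix \<open>M\<close>, then
  multiplying \<open>zy = Ay + x\<close> by \<open>M\<close> gives \<open>MAy + Mx = 0\<close>, which splits in the same way; starting with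
  \<open>M = C\<close> this yields \<open>CA\<^sup>kx = 0\<close> for all \<open>k\<close>.
\<close>

lemma observable_output_constant:
  assumes A: "A \<in> carrier_mat n n" and C: "C \<in> carrier_mat p n" and obs: "observable C A"
    and y: "y \<in> carrier_vec n" and x: "x \<in> carrier_vec n" and d: "d \<in> carrier_vec p"
    and state: "pencil A *\<^sub>v y = ratvec x" and out: "ratvec d + ratmat C *\<^sub>v y = 0\<^sub>v p"
  shows "d = 0\<^sub>v p" and "x = 0\<^sub>v n"
proof -
  have sp: "y \<in> strictly_proper_vecs n"
    using pencil_solution_strictly_proper[OF A y x state] .
  have Csp: "ratmat C *\<^sub>v y \<in> strictly_proper_vecs p"
    by (rule ratmat_mult_strictly_proper[OF C sp])
  have "ratmat C *\<^sub>v y + ratvec d = 0\<^sub>v p"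
    using out d C y by (subst comm_add_vec[of _ p]) auto
  note d0 = strictly_proper_plus_constant_eq_0[OF Csp d this]
  show "d = 0\<^sub>v p" by (fact d0(1))
  have next_power: "ratmat (M * A) *\<^sub>v y = 0\<^sub>v p \<and> M *\<^sub>v x = 0\<^sub>v p"
    if M: "M \<in> carrier_mat p n" and My: "ratmat M *\<^sub>v y = 0\<^sub>v p" for M
  proof -
    have "ratvec (M *\<^sub>v x) = ratmat M *\<^sub>v (pencil A *\<^sub>v y)"
      using const_fract.mult_mat_vec_hom[OF M x] state by simp
    also have "\<dots> = z_fract \<cdot>\<^sub>v (ratmat M *\<^sub>v y) - ratmat M *\<^sub>v (ratmat A *\<^sub>v y)"
      using A y M by (simp add: pencil_mult_vec mult_minus_distrib_mat_vec[of _ p n] mult_mat_vec[of _ p n])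
    also have "ratmat M *\<^sub>v (ratmat A *\<^sub>v y) = ratmat (M * A) *\<^sub>v y"
      using A y M by (simp add: const_fract.mat_hom_mult[OF M A])
    finally have eq: "ratvec (M *\<^sub>v x) = z_fract \<cdot>\<^sub>v 0\<^sub>v p - ratmat (M * A) *\<^sub>v y"
      using My by simp
    have "ratmat (M * A) *\<^sub>v y + ratvec (M *\<^sub>v x) = 0\<^sub>v p"
      unfolding eq using A y M by (intro eq_vecI) auto
    with strictly_proper_plus_constant_eq_0[OF ratmat_mult_strictly_proper[OF _ sp], of "M * A" p "M *\<^sub>v x"]
    show ?thesis using A M x by auto
  qed
  have "ratmat (C * A ^\<^sub>m k) *\<^sub>v y = 0\<^sub>v p" for k
  proof (induction k)
    case 0
    then show ?case using C A d0(2) by simp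
  next
    case (Suc k)
    have "C * A ^\<^sub>m Suc k = (C * A ^\<^sub>m k) * A"
      using C A by (simp add: assoc_mult_mat[of _ p n _ n _ n])
    then show ?case using next_power[OF _ Suc] C A by auto
  qed
  then have "(C * A ^\<^sub>m k) *\<^sub>v x = 0\<^sub>v p" for k
    using next_power[of "C * A ^\<^sub>m k"] C A by auto
  then have "x \<in> mat_kernel (C * A ^\<^sub>m k)" for k
    using C A x by (intro mat_kernelI[of _ p n]) auto
  then have "x \<in> (\<Inter>k. mat_kernel (C * A ^\<^sub>m k))" by blast
  then show "x = 0\<^sub>v n" using obs A unfolding observable_def by auto
qed


section \<open>The transfer function on the given functions\<close>

lemma append_rows_eqD:
  assumes "X \<in> carrier_mat n k" "X' \<in> carrier_mat n k"
    and "Y \<in> carrier_mat p k" "Y' \<in> carrier_mat p k"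
    and eq: "X @\<^sub>r Y = X' @\<^sub>r Y'"
  shows "X = X'" and "Y = Y'"
proof -
  have ij: "(X @\<^sub>r Y) $$ (i, j) = (X' @\<^sub>r Y') $$ (i, j)" for i j using eq by simp
  show "X = X'"
  proof (rule eq_matI)
    fix i j assume "i < dim_row X'" "j < dim_col X'"
    then show "X $$ (i, j) = X' $$ (i, j)" using assms(1-4) ij[of i j] by (simp add: append_rows_def)
  qed (use assms in auto)
  show "Y = Y'"
  proof (rule eq_matI)
    fix i j assume "i < dim_row Y'" "j < dim_col Y'"
    then show "Y $$ (i, j) = Y' $$ (i, j)"
      using assms(1-4) ij[of "n + i" j] by (simp add: append_rows_def)
  qed (use assms in auto)
qed

lemma four_block_mat_mult_append_rows:
  assumes "A \<in> carrier_mat n n" "B \<in> carrier_mat n q" "C \<in> carrier_mat p n" "D \<in> carrier_mat p q"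
    and "X \<in> carrier_mat n k" "Y \<in> carrier_mat q k"
  shows "four_block_mat A B C D * (X @\<^sub>r Y) = (A * X + B * Y) @\<^sub>r (C * X + D * Y)"
proof -
  have "four_block_mat A B C D * (X @\<^sub>r Y) = four_block_mat (A * X + B * Y)
      (A * 0\<^sub>m n 0 + B * 0\<^sub>m q 0) (C * X + D * Y) (C * 0\<^sub>m n 0 + D * 0\<^sub>m q 0)"
    unfolding append_rows_def using assms by (subst mult_four_block_mat[of _ n n _ q _ p _ _ k]) auto
  also have "\<dots> = (A * X + B * Y) @\<^sub>r (C * X + D * Y)"
    unfolding append_rows_def using assms by (intro cong_four_block_mat) auto
  finally show ?thesis .
qed

lemma ratmat_add:
  assumes "X \<in> carrier_mat a b" "Y \<in> carrier_mat a b"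
  shows "ratmat (X + Y) = ratmat X + ratmat Y"
  using assms by (intro eq_matI) auto

locale state_space_solution =
  fixes n p q m :: nat and A B C D H \<Lambda> P :: "complex mat"
  assumes A: "A \<in> carrier_mat n n" and B: "B \<in> carrier_mat n q"
    and C: "C \<in> carrier_mat p n" and D: "D \<in> carrier_mat p q"
    and H: "H \<in> carrier_mat q m" and \<Lambda>: "\<Lambda> \<in> carrier_mat m m" and P: "P \<in> carrier_mat n m"
    and state_equation: "A * P + B * H = P * \<Lambda>"
    and output_equation: "C * P + D * H = 0\<^sub>m p m"
begin

abbreviation F where "F \<equiv> transfer_function A B C D"

abbreviation G where "G \<equiv> ratmat H * resolvent \<Lambda>"

lemma F_carrier: "F \<in> carrier_mat p q"
  using A B C D resolvent_inverse(1)[OF A] by (simp add: transfer_function_def)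

lemma G_carrier: "G \<in> carrier_mat q m"
  using H resolvent_inverse(1)[OF \<Lambda>] by simp

text \<open>
  The state equation in the form \<open>(zI - A)P = P(zI - \<Lambda>) + BH\<close>.
\<close>

lemma pencil_P:
  assumes x: "x \<in> carrier_vec m"
  shows "pencil A *\<^sub>v (ratmat P *\<^sub>v x) =
    ratmat P *\<^sub>v (pencil \<Lambda> *\<^sub>v x) + ratmat B *\<^sub>v (ratmat H *\<^sub>v x)"
proof -
  have "ratmat P *\<^sub>v (ratmat \<Lambda> *\<^sub>v x) = ratmat (A * P + B * H) *\<^sub>v x"
    using P \<Lambda> x by (simp add: state_equation const_fract.mat_hom_mult[OF P \<Lambda>])
  also have "ratmat (A * P + B * H) = ratmat A * ratmat P + ratmat B * ratmat H"
    using A B H P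
    by (simp add: ratmat_add[of _ n m] const_fract.mat_hom_mult[OF A P]
        const_fract.mat_hom_mult[OF B H])
  also have "\<dots> *\<^sub>v x = ratmat A *\<^sub>v (ratmat P *\<^sub>v x) + ratmat B *\<^sub>v (ratmat H *\<^sub>v x)"
    using A B H P x by (simp add: add_mult_distrib_mat_vec[of _ n m])
  finally have "ratmat P *\<^sub>v (ratmat \<Lambda> *\<^sub>v x) = \<dots>" .
  moreover have "ratmat P *\<^sub>v (pencil \<Lambda> *\<^sub>v x) =
      z_fract \<cdot>\<^sub>v (ratmat P *\<^sub>v x) - ratmat P *\<^sub>v (ratmat \<Lambda> *\<^sub>v x)"
    using P \<Lambda> x
    by (simp add: pencil_mult_vec mult_minus_distrib_mat_vec[of _ n m] mult_mat_vec[of _ n m])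
  moreover have "pencil A *\<^sub>v (ratmat P *\<^sub>v x) =
      z_fract \<cdot>\<^sub>v (ratmat P *\<^sub>v x) - ratmat A *\<^sub>v (ratmat P *\<^sub>v x)"
    using P A x by (simp add: pencil_mult_vec)
  ultimately show ?thesis
    using A B H P x by (simp only:) (intro eq_vecI, simp_all)
qed

lemma output_P:
  assumes x: "x \<in> carrier_vec m"
  shows "ratmat C *\<^sub>v (ratmat P *\<^sub>v x) + ratmat D *\<^sub>v (ratmat H *\<^sub>v x) = 0\<^sub>v p"
proof -
  have "ratmat C *\<^sub>v (ratmat P *\<^sub>v x) + ratmat D *\<^sub>v (ratmat H *\<^sub>v x) =
      (ratmat C * ratmat P + ratmat D * ratmat H) *\<^sub>v x"
    using C D H P x by (simp add: add_mult_distrib_mat_vec[of _ p m])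
  also have "ratmat C * ratmat P + ratmat D * ratmat H = ratmat (C * P + D * H)"
    using C D H P
    by (simp add: ratmat_add[of _ p m] const_fract.mat_hom_mult[OF C P]
        const_fract.mat_hom_mult[OF D H])
  also have "\<dots> *\<^sub>v x = 0\<^sub>v p"
    unfolding output_equation using x by (intro eq_vecI) (auto simp: scalar_prod_def)
  finally show ?thesis .
qed

text \<open>
  Let \<open>x = (zI - \<Lambda>)\<^sup>-\<^sup>1\<beta>\<close>, so that \<open>G\<beta> = Hx\<close>, and let \<open>y\<close> be the state belonging to the input
  \<open>G\<beta> + u\<close>.  By \<open>pencil_P\<close> and \<open>output_P\<close> the trajectory \<open>Px\<close> accounts for the contribution of \<open>G\<beta>\<close>
  to \<open>y\<close> except for the initial condition \<open>P\<beta>\<close>, and produces no output; the difference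
  \<open>e = y - Px\<close> is what remains.
\<close>

lemma F_mult_G_plus:
  assumes \<beta>: "\<beta> \<in> carrier_vec m" and u: "u \<in> carrier_vec q"
  obtains e where "e \<in> carrier_vec n"
    and "pencil A *\<^sub>v e = ratmat B *\<^sub>v u - ratvec (P *\<^sub>v \<beta>)"
    and "F *\<^sub>v (G *\<^sub>v ratvec \<beta> + u) = ratmat D *\<^sub>v u + ratmat C *\<^sub>v e"
proof -
  note rA = resolvent_inverse[OF A] and r\<Lambda> = resolvent_inverse[OF \<Lambda>]
  define x where "x = resolvent \<Lambda> *\<^sub>v ratvec \<beta>"
  define h where "h = ratmat H *\<^sub>v x"
  define y where "y = resolvent A *\<^sub>v (ratmat B *\<^sub>v (h + u))"
  have x: "x \<in> carrier_vec m" using r\<Lambda>(1) \<beta> by (simp add: x_def)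
  have h: "h \<in> carrier_vec q" using H x by (simp add: h_def)
  have y: "y \<in> carrier_vec n" using rA(1) B h u by (simp add: y_def)
  have Px: "ratmat P *\<^sub>v x \<in> carrier_vec n" using P x by simp
  have Gh: "G *\<^sub>v ratvec \<beta> = h" using H r\<Lambda>(1) \<beta> by (simp add: h_def x_def)
  have "pencil \<Lambda> *\<^sub>v x = (pencil \<Lambda> * resolvent \<Lambda>) *\<^sub>v ratvec \<beta>"
    using r\<Lambda>(1) pencil_carrier[OF \<Lambda>] \<beta> by (simp add: x_def)
  then have px: "pencil \<Lambda> *\<^sub>v x = ratvec \<beta>" using r\<Lambda>(2) \<beta> by simp
  have "pencil A *\<^sub>v y = (pencil A * resolvent A) *\<^sub>v (ratmat B *\<^sub>v (h + u))"
    using rA(1) pencil_carrier[OF A] B h u by (simp add: y_def)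
  then have py: "pencil A *\<^sub>v y = ratmat B *\<^sub>v h + ratmat B *\<^sub>v u"
    using rA(2) B h u by (simp add: mult_add_distrib_mat_vec[of _ n q])
  show thesis
  proof (rule that[of "y - ratmat P *\<^sub>v x"])
    show "y - ratmat P *\<^sub>v x \<in> carrier_vec n" using y Px by simp
    have "pencil A *\<^sub>v (y - ratmat P *\<^sub>v x) =
        (ratmat B *\<^sub>v h + ratmat B *\<^sub>v u) - (ratvec (P *\<^sub>v \<beta>) + ratmat B *\<^sub>v h)"
      unfolding mult_minus_distrib_mat_vec[OF pencil_carrier[OF A] y Px] py pencil_P[OF x] px
        const_fract.mult_mat_vec_hom[OF P \<beta>] h_def ..
    also have "\<dots> = ratmat B *\<^sub>v u - ratvec (P *\<^sub>v \<beta>)"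
      using B P \<beta> h u by (intro eq_vecI) auto
    finally show "pencil A *\<^sub>v (y - ratmat P *\<^sub>v x) = ratmat B *\<^sub>v u - ratvec (P *\<^sub>v \<beta>)" .
    have "F *\<^sub>v (h + u) = ratmat D *\<^sub>v (h + u) + ratmat C *\<^sub>v y"
      unfolding transfer_function_def y_def using A B C D rA(1) h u
      by (simp add: add_mult_distrib_mat_vec[of _ p q] assoc_mult_mat_vec[of _ p n _ q]
          assoc_mult_mat_vec[of _ p n _ n])
    also have "ratmat C *\<^sub>v y = ratmat C *\<^sub>v (y - ratmat P *\<^sub>v x) + ratmat C *\<^sub>v (ratmat P *\<^sub>v x)"
      unfolding mult_minus_distrib_mat_vec[of "ratmat C" p n, OF _ y Px, simplified, OF C]
      using C y Px by (intro eq_vecI) auto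
    also have "ratmat D *\<^sub>v (h + u) = ratmat D *\<^sub>v h + ratmat D *\<^sub>v u"
      using D h u by (simp add: mult_add_distrib_mat_vec[of _ p q])
    also have "(ratmat D *\<^sub>v h + ratmat D *\<^sub>v u) +
        (ratmat C *\<^sub>v (y - ratmat P *\<^sub>v x) + ratmat C *\<^sub>v (ratmat P *\<^sub>v x)) =
        (ratmat D *\<^sub>v u + ratmat C *\<^sub>v (y - ratmat P *\<^sub>v x)) +
        (ratmat C *\<^sub>v (ratmat P *\<^sub>v x) + ratmat D *\<^sub>v h)"
      using C D h u y Px by (intro eq_vecI) auto
    also have "\<dots> = ratmat D *\<^sub>v u + ratmat C *\<^sub>v (y - ratmat P *\<^sub>v x)"
      unfolding h_def output_P[OF x] using C D u y Px by (intro eq_vecI) auto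
    finally show "F *\<^sub>v (G *\<^sub>v ratvec \<beta> + u) =
        ratmat D *\<^sub>v u + ratmat C *\<^sub>v (y - ratmat P *\<^sub>v x)" unfolding Gh .
  qed
qed

text \<open>
  In this case \<open>(zI - A)e = Br - P\<beta> = 0\<close>, so \<open>e = 0\<close> in \<open>F_mult_G_plus\<close>.
\<close>

lemma zero_state_imp_kernel:
  assumes \<beta>: "\<beta> \<in> carrier_vec m" and r: "r \<in> carrier_vec q"
    and "B *\<^sub>v r = P *\<^sub>v \<beta>" and "D *\<^sub>v r = 0\<^sub>v p"
  shows "F *\<^sub>v (G *\<^sub>v ratvec \<beta> + ratvec r) = 0\<^sub>v p"
proof -
  obtain e where e: "e \<in> carrier_vec n"
      "pencil A *\<^sub>v e = ratmat B *\<^sub>v ratvec r - ratvec (P *\<^sub>v \<beta>)"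
      "F *\<^sub>v (G *\<^sub>v ratvec \<beta> + ratvec r) = ratmat D *\<^sub>v ratvec r + ratmat C *\<^sub>v e"
    using F_mult_G_plus[OF \<beta>, of "ratvec r"] r by auto
  have "pencil A *\<^sub>v e = 0\<^sub>v n"
    unfolding e(2) const_fract.mult_mat_vec_hom[OF B r, symmetric] assms(3)
    using P \<beta> by (intro eq_vecI) auto
  moreover have "e = resolvent A *\<^sub>v (pencil A *\<^sub>v e)"
    using resolvent_inverse[OF A] pencil_carrier[OF A] e(1)
    by (subst assoc_mult_mat_vec[symmetric, of _ n n _ n]) auto
  ultimately have "e = 0\<^sub>v n"
    using resolvent_inverse(1)[OF A] by (auto intro!: eq_vecI)
  then have "ratmat C *\<^sub>v e = 0\<^sub>v p" using C by (auto intro!: eq_vecI)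
  then show ?thesis
    unfolding e(3) const_fract.mult_mat_vec_hom[OF D r, symmetric] assms(4)
    by (auto intro!: eq_vecI)
qed

text \<open>
  Conversely, \<open>F_mult_G_plus\<close> gives \<open>Dr + Ce = 0\<close> with \<open>(zI - A)e\<close> the constant \<open>Br - P\<beta>\<close>; by
  observability both constants vanish.
\<close>

lemma kernel_imp_zero_state:
  assumes obs: "observable C A" and \<beta>: "\<beta> \<in> carrier_vec m" and r: "r \<in> carrier_vec q"
    and ker: "F *\<^sub>v (G *\<^sub>v ratvec \<beta> + ratvec r) = 0\<^sub>v p"
  shows "B *\<^sub>v r = P *\<^sub>v \<beta>" and "D *\<^sub>v r = 0\<^sub>v p"
proof -
  obtain e where e: "e \<in> carrier_vec n"
      "pencil A *\<^sub>v e = ratmat B *\<^sub>v ratvec r - ratvec (P *\<^sub>v \<beta>)"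
      "F *\<^sub>v (G *\<^sub>v ratvec \<beta> + ratvec r) = ratmat D *\<^sub>v ratvec r + ratmat C *\<^sub>v e"
    using F_mult_G_plus[OF \<beta>, of "ratvec r"] r by auto
  have "pencil A *\<^sub>v e = ratvec (B *\<^sub>v r - P *\<^sub>v \<beta>)"
    unfolding e(2) const_fract.mult_mat_vec_hom[OF B r, symmetric]
    using B P r \<beta> by (intro eq_vecI) auto
  moreover have "ratvec (D *\<^sub>v r) + ratmat C *\<^sub>v e = 0\<^sub>v p"
    using ker unfolding e(3) const_fract.mult_mat_vec_hom[OF D r, symmetric] .
  ultimately have *: "D *\<^sub>v r = 0\<^sub>v p" "B *\<^sub>v r - P *\<^sub>v \<beta> = 0\<^sub>v n"
    using observable_output_constant[OF A C obs e(1), of "B *\<^sub>v r - P *\<^sub>v \<beta>" "D *\<^sub>v r"] B P D r \<beta>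
    by auto
  show "D *\<^sub>v r = 0\<^sub>v p" by fact
  show "B *\<^sub>v r = P *\<^sub>v \<beta>"
  proof (rule eq_vecI)
    fix i assume "i < dim_vec (P *\<^sub>v \<beta>)"
    then show "(B *\<^sub>v r) $ i = (P *\<^sub>v \<beta>) $ i"
      using arg_cong[OF *(2), of "\<lambda>v. v $ i"] B P by auto
  qed (use B P in auto)
qed

text \<open>
  The shift relation: multiplication by \<open>z\<close> acts on the strictly proper functions \<open>G\<beta>\<close> as \<open>\<Lambda>\<close>,
  up to a constant.
\<close>

lemma z_mult_G:
  assumes \<beta>: "\<beta> \<in> carrier_vec m"
  shows "z_fract \<cdot>\<^sub>v (G *\<^sub>v ratvec \<beta>) = G *\<^sub>v ratvec (\<Lambda> *\<^sub>v \<beta>) + ratvec (H *\<^sub>v \<beta>)"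
proof -
  note r\<Lambda> = resolvent_inverse[OF \<Lambda>]
  have b: "ratvec \<beta> \<in> carrier_vec m" using \<beta> by simp
  have "ratvec \<beta> = (resolvent \<Lambda> * pencil \<Lambda>) *\<^sub>v ratvec \<beta>" using r\<Lambda>(3) b by simp
  also have "\<dots> = resolvent \<Lambda> *\<^sub>v (z_fract \<cdot>\<^sub>v ratvec \<beta> - ratmat \<Lambda> *\<^sub>v ratvec \<beta>)"
    using r\<Lambda>(1) pencil_carrier[OF \<Lambda>] b
    by (simp add: assoc_mult_mat_vec[of _ m m _ m] pencil_mult_vec[OF \<Lambda>])
  finally have "ratmat H *\<^sub>v ratvec \<beta> =
      G *\<^sub>v (z_fract \<cdot>\<^sub>v ratvec \<beta> - ratmat \<Lambda> *\<^sub>v ratvec \<beta>)"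
    using H r\<Lambda>(1) \<Lambda> b by (simp add: assoc_mult_mat_vec[of _ q m _ m])
  also have "\<dots> = z_fract \<cdot>\<^sub>v (G *\<^sub>v ratvec \<beta>) - G *\<^sub>v (ratmat \<Lambda> *\<^sub>v ratvec \<beta>)"
    using G_carrier \<Lambda> b by (simp add: mult_minus_distrib_mat_vec[of _ q m] mult_mat_vec[of _ q m])
  finally show ?thesis
    unfolding const_fract.mult_mat_vec_hom[OF H \<beta>] const_fract.mult_mat_vec_hom[OF \<Lambda> \<beta>]
    using G_carrier H \<Lambda> b by (auto intro!: eq_vecI)
qed

end


section \<open>Coordinates with respect to a basis of the quotient\<close>

context linear_map
begin

text \<open>
  Linear combinations are indexed by sets of vectors, so transporting one along \<open>T\<close> needs \<open>T\<close>
  to be injective on that set, but not on the whole space.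
\<close>

lemma lincomb_image:
  assumes "finite U" "U \<subseteq> carrier V" "inj_on T U" "a \<in> T ` U \<rightarrow> carrier K"
  shows "W.module.lincomb a (T ` U) = T (V.module.lincomb (a \<circ> T) U)"
  using assms
proof (induction U)
  case empty
  then show ?case by simp
next
  case (insert x U)
  have aT: "a \<circ> T \<in> insert x U \<rightarrow> carrier K" using insert.prems(3) by auto
  have aU: "a \<in> T ` U \<rightarrow> carrier K" "a \<circ> T \<in> U \<rightarrow> carrier K" using insert.prems(3) by auto
  have "W.module.lincomb a (T ` insert x U) = a (T x) \<odot>\<^bsub>W\<^esub> T x \<oplus>\<^bsub>W\<^esub> W.module.lincomb a (T ` U)"
    unfolding image_insert using insert.hyps insert.prems
    by (intro W.lincomb_insert2) auto
  also have "\<dots> = a (T x) \<odot>\<^bsub>W\<^esub> T x \<oplus>\<^bsub>W\<^esub> T (V.module.lincomb (a \<circ> T) U)"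
    using insert.IH[OF _ _ aU(1)] insert.prems by (simp add: comp_def)
  also have "\<dots> = T (a (T x) \<odot>\<^bsub>V\<^esub> x \<oplus>\<^bsub>V\<^esub> V.module.lincomb (a \<circ> T) U)"
    using insert.prems aU V.module.lincomb_closed[of U "a \<circ> T"] by (subst f_add) auto
  also have "a (T x) \<odot>\<^bsub>V\<^esub> x \<oplus>\<^bsub>V\<^esub> V.module.lincomb (a \<circ> T) U = V.module.lincomb (a \<circ> T) (insert x U)"
    using V.lincomb_insert2[of U "a \<circ> T" x] insert.hyps insert.prems aT by auto
  finally show ?case .
qed

lemma trivial_kernel_if_images_independent:
  assumes U: "finite U" "U \<subseteq> carrier V" "V.module.gen_set U"
    and inj: "inj_on T U" and indep: "W.module.lin_indpt (T ` U)"
    and v: "v \<in> carrier V" "T v = \<zero>\<^bsub>W\<^esub>"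
  shows "v = \<zero>\<^bsub>V\<^esub>"
proof -
  have "v \<in> V.module.span U" using U v by simp
  then obtain a where a: "a \<in> U \<rightarrow> carrier K" "V.module.lincomb a U = v"
    using V.module.finite_in_span[OF U(1,2)] by blast
  define b where "b = a \<circ> inv_into U T"
  have b: "b (T u) = a u" if "u \<in> U" for u
    using that inj by (simp add: b_def)
  have bK: "b \<in> T ` U \<rightarrow> carrier K" using b a(1) by auto
  have "V.module.lincomb (b \<circ> T) U = v"
    unfolding a(2)[symmetric] using U b a(1) by (intro V.module.lincomb_cong) auto
  then have "W.module.lincomb b (T ` U) = \<zero>\<^bsub>W\<^esub>"
    using lincomb_image[OF U(1,2) inj bK] v by simp
  then have "b w = \<zero>\<^bsub>K\<^esub>" if "w \<in> T ` U" for w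
    using W.module.lin_dep_crit[of "T ` U" "T ` U" b w] that indep U(1) bK by auto
  then have "a u = \<zero>\<^bsub>K\<^esub>" if "u \<in> U" for u
    using b that by force
  then have "V.module.lincomb a U = V.module.lincomb (\<lambda>_. \<zero>\<^bsub>K\<^esub>) U"
    by (rule V.module.lincomb_cong[OF refl U(2)]) simp_all
  also have "\<dots> = \<zero>\<^bsub>V\<^esub>"
    by (rule V.lincomb_zero[OF U(2)]) auto
  finally show ?thesis using a(2) by simp
qed

end

lemma submodule_module_vecI:
  fixes S :: "complex vec set"
  assumes "S \<subseteq> carrier_vec m" "0\<^sub>v m \<in> S"
    and "\<And>v w. v \<in> S \<Longrightarrow> w \<in> S \<Longrightarrow> v + w \<in> S"
    and "\<And>c v. v \<in> S \<Longrightarrow> c \<cdot>\<^sub>v v \<in> S"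
  shows "submodule class_ring S (module_vec TYPE(complex) m)"
proof (rule submodule.intro)
  interpret X: vec_space "TYPE(complex)" m .
  show "Module.module class_ring (module_vec TYPE(complex) m)"
    by (rule X.module_axioms)
qed (use assms in \<open>simp_all add: module_vec_simps\<close>)

lemma submodule_strictly_proper_kernel:
  "submodule class_ring (strictly_proper_kernel F) (rational_vecs (dim_col F))"
  unfolding strictly_proper_kernel_def
  by (intro submodule_inter submodule_mat_kernel submodule_strictly_proper_vecs)

lemma submodule_fzk_numerator:
  "submodule class_ring (fzk_numerator F) (rational_vecs (dim_col F))"
proof -
  let ?M = "rational_vecs (dim_col F)"
  interpret M: vectorspace class_ring ?M by (rule vectorspace_rational_vecs)
  have sum: "set_add ?M S T = M.submodule_sum S T" for S T
    unfolding set_add_def' M.submodule_sum_def by fast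
  show ?thesis
    unfolding fzk_numerator_def sum
    by (intro submodule_inter M.sum_is_submodule submodule_strictly_proper_vecs
        submodule_inverse_image_poly submodule_polynomial_vecs)
qed

lemma fzk_numerator_carrier: "fzk_numerator F \<subseteq> carrier_vec (dim_col F)"
  by (auto simp: fzk_numerator_def strictly_proper_vecs_def)

lemma strictly_proper_kernel_carrier: "strictly_proper_kernel F \<subseteq> carrier_vec (dim_col F)"
  by (auto simp: strictly_proper_kernel_def strictly_proper_vecs_def)

lemma kernel_class_alt: "kernel_class F v = {h + v |h. h \<in> strictly_proper_kernel F}"
  by (auto simp: kernel_class_def a_r_coset_def' rational_vecs_def)

lemma uminus_eq_smult: "- v = const_fract (- 1) \<cdot>\<^sub>v v"
  by (intro eq_vecI) (simp_all add: const_fract.hom_uminus)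

lemma strictly_proper_kernel_uminus:
  assumes "h \<in> strictly_proper_kernel F" shows "- h \<in> strictly_proper_kernel F"
  using submodule_rational_vecsD(3)[OF submodule_strictly_proper_kernel assms, of "- 1"]
  by (simp only: uminus_eq_smult)

text \<open>
  The three facts below describe the quotient operations on representatives; they make
  \<open>\<beta> \<mapsto> kernel_class F (G\<beta>)\<close> a linear map into the quotient.
\<close>

lemma kernel_class_eq_iff:
  assumes v: "v \<in> carrier_vec (dim_col F)" and w: "w \<in> carrier_vec (dim_col F)"
  shows "kernel_class F v = kernel_class F w \<longleftrightarrow> v - w \<in> strictly_proper_kernel F"
proof
  note sub = submodule_rational_vecsD[OF submodule_strictly_proper_kernel[of F]]
  note car = strictly_proper_kernel_carrier[of F, THEN subsetD]
  assume "kernel_class F v = kernel_class F w"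
  moreover have "0\<^sub>v (dim_col F) + v \<in> kernel_class F v"
    unfolding kernel_class_alt using sub(1) by blast
  ultimately obtain h where h: "h \<in> strictly_proper_kernel F" "v = h + w"
    using v unfolding kernel_class_alt by auto
  then have "v - w = h" using car[OF h(1)] w by auto
  then show "v - w \<in> strictly_proper_kernel F" using h by simp
next
  note sub = submodule_rational_vecsD[OF submodule_strictly_proper_kernel[of F]]
  note car = strictly_proper_kernel_carrier[of F, THEN subsetD]
  have incl: "kernel_class F v \<subseteq> kernel_class F w"
    if "v - w \<in> strictly_proper_kernel F" "v \<in> carrier_vec (dim_col F)" "w \<in> carrier_vec (dim_col F)"
    for v w
  proof
    fix x assume "x \<in> kernel_class F v"
    then obtain h where h: "h \<in> strictly_proper_kernel F" "x = h + v"
      unfolding kernel_class_alt by blast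
    have "x = (h + (v - w)) + w"
      unfolding h(2) using car[OF h(1)] that by (intro eq_vecI) auto
    then show "x \<in> kernel_class F w"
      unfolding kernel_class_alt using sub(2)[OF h(1) that(1)] by blast
  qed
  assume vw: "v - w \<in> strictly_proper_kernel F"
  have "w - v = - (v - w)" using v w by (intro eq_vecI) auto
  then have "w - v \<in> strictly_proper_kernel F" using strictly_proper_kernel_uminus[OF vw] by simp
  then show "kernel_class F v = kernel_class F w"
    using incl[OF vw v w] incl[OF _ w v] by blast
qed

lemma kernel_class_add:
  assumes v: "v \<in> carrier_vec (dim_col F)" and w: "w \<in> carrier_vec (dim_col F)"
  shows "set_add (rational_vecs (dim_col F)) (kernel_class F v) (kernel_class F w) = kernel_class F (v + w)"
proof -
  note sub = submodule_rational_vecsD[OF submodule_strictly_proper_kernel[of F]]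
  note car = strictly_proper_kernel_carrier[of F, THEN subsetD]
  have "(h + v) + (h' + w) = (h + h') + (v + w)"
    if "h \<in> strictly_proper_kernel F" "h' \<in> strictly_proper_kernel F" for h h'
    using car[OF that(1)] car[OF that(2)] v w by (intro eq_vecI) auto
  then have "(h + v) + (h' + w) \<in> kernel_class F (v + w)"
    if "h \<in> strictly_proper_kernel F" "h' \<in> strictly_proper_kernel F" for h h'
    unfolding kernel_class_alt using sub(2)[OF that] that by auto
  moreover have "\<exists>a\<in>kernel_class F v. \<exists>b\<in>kernel_class F w. x = a + b"
    if "x \<in> kernel_class F (v + w)" for x
  proof -
    obtain h where h: "h \<in> strictly_proper_kernel F" "x = h + (v + w)"
      using \<open>x \<in> kernel_class F (v + w)\<close> unfolding kernel_class_alt by blast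
    have "x = (h + v) + (0\<^sub>v (dim_col F) + w)"
      unfolding h(2) using car[OF h(1)] v w by (intro eq_vecI) auto
    moreover have "h + v \<in> kernel_class F v" "0\<^sub>v (dim_col F) + w \<in> kernel_class F w"
      unfolding kernel_class_alt using h(1) sub(1) by blast+
    ultimately show ?thesis by blast
  qed
  moreover have "set_add (rational_vecs (dim_col F)) S S' = {a + b |a b. a \<in> S \<and> b \<in> S'}" for S S'
    by (auto simp: set_add_def' rational_vecs_def)
  ultimately show ?thesis
    unfolding kernel_class_alt[of F v] kernel_class_alt[of F w]
    by (intro equalityI subsetI) (fastforce, fastforce)
qed

lemma kernel_class_smult:
  assumes v: "v \<in> carrier_vec (dim_col F)"
  shows "(\<Union>x\<in>kernel_class F v. kernel_class F (const_fract c \<cdot>\<^sub>v x)) = kernel_class F (const_fract c \<cdot>\<^sub>v v)"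
proof -
  note sub = submodule_rational_vecsD[OF submodule_strictly_proper_kernel[of F]]
  note car = strictly_proper_kernel_carrier[of F, THEN subsetD]
  have "kernel_class F (const_fract c \<cdot>\<^sub>v x) = kernel_class F (const_fract c \<cdot>\<^sub>v v)"
    if "x \<in> kernel_class F v" for x
  proof -
    obtain h where h: "h \<in> strictly_proper_kernel F" "x = h + v"
      using \<open>x \<in> kernel_class F v\<close> unfolding kernel_class_alt by blast
    have "const_fract c \<cdot>\<^sub>v x - const_fract c \<cdot>\<^sub>v v = const_fract c \<cdot>\<^sub>v h"
      unfolding h(2) using car[OF h(1)] v by (intro eq_vecI) (auto simp: distrib_left)
    then show ?thesis
      using sub(3)[OF h(1), of c] car[OF h(1)] v h(2) by (subst kernel_class_eq_iff) auto
  qed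
  moreover have "kernel_class F v \<noteq> {}"
    unfolding kernel_class_alt using sub(1) by blast
  ultimately show ?thesis by auto
qed

lemma mult_ratvec_add:
  assumes "G \<in> carrier_mat q m" "\<beta> \<in> carrier_vec m" "\<gamma> \<in> carrier_vec m"
  shows "G *\<^sub>v ratvec (\<beta> + \<gamma>) = G *\<^sub>v ratvec \<beta> + G *\<^sub>v ratvec \<gamma>"
proof -
  have "ratvec (\<beta> + \<gamma>) = ratvec \<beta> + ratvec \<gamma>" using assms by (intro eq_vecI) auto
  then show ?thesis using assms by (simp add: mult_add_distrib_mat_vec[of _ q m])
qed

lemma mult_ratvec_smult:
  assumes "G \<in> carrier_mat q m" "\<beta> \<in> carrier_vec m"
  shows "G *\<^sub>v ratvec (c \<cdot>\<^sub>v \<beta>) = const_fract c \<cdot>\<^sub>v (G *\<^sub>v ratvec \<beta>)"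
  using assms by (simp add: const_fract.vec_hom_smult mult_mat_vec[of _ q m])

lemma mult_ratvec_zero:
  assumes "G \<in> carrier_mat q m"
  shows "G *\<^sub>v ratvec (0\<^sub>v m) = 0\<^sub>v q"
  using assms by (intro eq_vecI) (auto simp: scalar_prod_def)

lemma mult_ratvec_unit:
  assumes "G \<in> carrier_mat q m" "j < m"
  shows "G *\<^sub>v ratvec (unit_vec m j) = col G j"
proof -
  have "ratvec (unit_vec m j) = unit_vec m j" by (intro eq_vecI) (auto simp: unit_vec_def)
  then show ?thesis using assms by (intro eq_vecI) auto
qed

text \<open>
  Over the constants, \<open>\<beta> \<mapsto> G\<beta>\<close> is linear and sends unit vectors to the columns of \<open>G\<close>, so its
  values lie in every constant-linear subspace containing these columns.
\<close>

lemma mult_ratvec_in_submodule: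
  assumes G: "G \<in> carrier_mat q m" and S: "submodule class_ring S (rational_vecs q)"
    and cols: "set (cols G) \<subseteq> S" and \<beta>: "\<beta> \<in> carrier_vec m"
  shows "G *\<^sub>v ratvec \<beta> \<in> S"
proof -
  interpret X: vec_space "TYPE(complex)" m .
  note sub = submodule_rational_vecsD[OF S]
  let ?N = "{\<beta> \<in> carrier_vec m. G *\<^sub>v ratvec \<beta> \<in> S}"
  have "submodule class_ring ?N X.V"
    using sub G
    by (intro submodule_module_vecI) (auto simp: mult_ratvec_zero mult_ratvec_add mult_ratvec_smult)
  moreover have "set (unit_vecs m) \<subseteq> ?N"
    using cols G by (auto simp: unit_vecs_def mult_ratvec_unit cols_def)
  ultimately have "X.span (set (unit_vecs m)) \<subseteq> ?N" by (intro X.span_is_subset)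
  then show ?thesis using \<beta> unfolding X.span_unit_vecs_is_carrier by blast
qed

text \<open>
  The linear map \<open>\<beta> \<mapsto> kernel_class F (G\<beta>)\<close> sends the unit vectors injectively onto the given
  basis.  As the basis spans, the map is onto, and as it is independent, the kernel is trivial.
  On the level of representatives these are the existence and the uniqueness of coordinates
  modulo the strictly proper kernel elements.
\<close>

lemma columns_basis_fzk_coordinates:
  assumes F: "dim_col F = q" and G: "G \<in> carrier_mat q m" and basis: "columns_basis_fzk F G"
  shows "\<And>\<beta>. \<beta> \<in> carrier_vec m \<Longrightarrow> G *\<^sub>v ratvec \<beta> \<in> fzk_numerator F"
    and "\<And>s. s \<in> fzk_numerator F \<Longrightarrow>
      \<exists>\<beta>\<in>carrier_vec m. s - G *\<^sub>v ratvec \<beta> \<in> strictly_proper_kernel F"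
    and "\<And>\<beta>. \<beta> \<in> carrier_vec m \<Longrightarrow> G *\<^sub>v ratvec \<beta> \<in> strictly_proper_kernel F \<Longrightarrow> \<beta> = 0\<^sub>v m"
proof -
  let ?T = "\<lambda>\<beta>. kernel_class F (G *\<^sub>v ratvec \<beta>)" and ?U = "set (unit_vecs m)"
  have cols: "set (cols G) \<subseteq> fzk_numerator F"
    and dist: "distinct (map (kernel_class F) (cols G))"
    and bas: "vectorspace.basis class_ring (fzk_space F) (kernel_class F ` set (cols G))"
    using basis unfolding columns_basis_fzk_def by auto
  show num: "G *\<^sub>v ratvec \<beta> \<in> fzk_numerator F" if "\<beta> \<in> carrier_vec m" for \<beta>
    using mult_ratvec_in_submodule[OF G _ cols that] submodule_fzk_numerator[of F] F by simp
  have numD: "G *\<^sub>v ratvec \<beta> \<in> carrier_vec (dim_col F)" if "\<beta> \<in> carrier_vec m" for \<beta>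
    using num[OF that] fzk_numerator_carrier by blast
  have fzk: "carrier (fzk_space F) = kernel_class F ` fzk_numerator F"
    "add (fzk_space F) = set_add (rational_vecs (dim_col F))"
    "zero (fzk_space F) = strictly_proper_kernel F"
    "module.smult (fzk_space F) = (\<lambda>c X. \<Union>x\<in>X. kernel_class F (const_fract c \<cdot>\<^sub>v x))"
    by (simp_all add: fzk_space_def quotient_space_def kernel_class_def rational_vecs_def)
  interpret X: vec_space "TYPE(complex)" m .
  interpret T: linear_map class_ring "X.V" "fzk_space F" ?T
  proof (intro linear_map.intro mod_hom.intro mod_hom_axioms.intro vectorspace_fzk_space)
    show "vectorspace class_ring X.V" by (rule X.vectorspace_axioms)
    show "Module.module class_ring X.V" by (rule X.module_axioms)
    show "Module.module class_ring (fzk_space F)"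
      using vectorspace_fzk_space unfolding vectorspace_def by blast
    show "?T \<in> LinearCombinations.module_hom class_ring X.V (fzk_space F)"
      unfolding LinearCombinations.module_hom_def using num numD G
      by (auto simp: fzk module_vec_simps kernel_class_add kernel_class_smult mult_ratvec_add
          mult_ratvec_smult)
  qed
  have TU: "?T ` ?U = kernel_class F ` set (cols G)"
    using G by (auto simp: unit_vecs_def cols_def mult_ratvec_unit image_image)
  have injU: "inj_on ?T ?U"
  proof (rule inj_onI)
    fix u w assume "u \<in> ?U" "w \<in> ?U" and eq: "?T u = ?T w"
    then obtain i j where ij: "u = unit_vec m i" "w = unit_vec m j" "i < m" "j < m"
      by (auto simp: unit_vecs_def)
    then have "map (kernel_class F) (cols G) ! i = map (kernel_class F) (cols G) ! j"
      using eq G by (simp add: mult_ratvec_unit)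
    then have "i = j" using dist ij G by (subst (asm) nth_eq_iff_index_eq) auto
    then show "u = w" using ij by simp
  qed
  have indep: "\<not> T.W.module.lin_dep (?T ` ?U)" and gen: "T.W.module.span (?T ` ?U) = carrier (fzk_space F)"
    using bas unfolding TU T.W.basis_def by auto
  show "\<beta> = 0\<^sub>v m" if \<beta>: "\<beta> \<in> carrier_vec m" "G *\<^sub>v ratvec \<beta> \<in> strictly_proper_kernel F" for \<beta>
  proof -
    have "?T \<beta> = kernel_class F (0\<^sub>v (dim_col F))"
      using \<beta> strictly_proper_kernel_carrier[of F] by (subst kernel_class_eq_iff) auto
    also have "\<dots> = strictly_proper_kernel F"
      unfolding kernel_class_alt using strictly_proper_kernel_carrier[of F]
      by (force simp: subset_iff)
    finally have "?T \<beta> = zero (fzk_space F)" by (simp add: fzk)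
    then show ?thesis
      using T.trivial_kernel_if_images_independent[of ?U \<beta>] indep injU \<beta>(1)
        X.span_unit_vecs_is_carrier by (simp add: module_vec_simps unit_vecs_carrier)
  qed
  show "\<exists>\<beta>\<in>carrier_vec m. s - G *\<^sub>v ratvec \<beta> \<in> strictly_proper_kernel F"
    if s: "s \<in> fzk_numerator F" for s
  proof -
    have "?T ` ?U \<subseteq> T.im" using unit_vecs_carrier[of m] by (auto simp: T.im_def module_vec_simps)
    then have "T.W.module.span (?T ` ?U) \<subseteq> T.im" by (intro T.W.module.span_is_subset T.im_is_submodule)
    then have "kernel_class F s \<in> T.im" using s unfolding gen fzk by blast
    then obtain \<beta> where \<beta>: "\<beta> \<in> carrier_vec m" "kernel_class F s = ?T \<beta>"
      by (auto simp: T.im_def module_vec_simps)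
    then show ?thesis
      using kernel_class_eq_iff[of s F] numD s fzk_numerator_carrier[of F] by blast
  qed
qed

section \<open>The reachable space\<close>

lemma pow_mat_commute:
  assumes "A \<in> carrier_mat m m"
  shows "A * A ^\<^sub>m i = A ^\<^sub>m i * A"
proof (induction i)
  case 0
  then show ?case using assms by simp
next
  case (Suc i)
  have "A * A ^\<^sub>m Suc i = (A * A ^\<^sub>m i) * A"
    using assms by (simp add: assoc_mult_mat[of _ m m _ m _ m])
  then show ?case by (simp add: Suc)
qed

lemma reachable_generators_carrier:
  assumes "\<Lambda> \<in> carrier_mat m m" "\<alpha> \<in> carrier_mat m k"
  shows "(\<Union>i. set (cols (\<Lambda> ^\<^sub>m i * \<alpha>))) \<subseteq> carrier_vec m"
proof -
  have "set (cols (\<Lambda> ^\<^sub>m i * \<alpha>)) \<subseteq> carrier_vec m" for i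
    using cols_dim[of "\<Lambda> ^\<^sub>m i * \<alpha>"] assms by simp
  then show ?thesis by blast
qed

lemma reachable_space_submodule:
  assumes \<Lambda>: "\<Lambda> \<in> carrier_mat m m" and \<alpha>: "\<alpha> \<in> carrier_mat m k"
  shows "submodule class_ring (reachable_space \<Lambda> \<alpha>) (module_vec TYPE(complex) m)"
proof -
  interpret X: vec_space "TYPE(complex)" m .
  show ?thesis
    using X.span_is_submodule[OF reachable_generators_carrier[OF \<Lambda> \<alpha>]] \<Lambda> by (simp add: reachable_space_def)
qed

lemma submodule_module_vecD:
  fixes S :: "complex vec set"
  assumes "submodule class_ring S (module_vec TYPE(complex) m)"
  shows "S \<subseteq> carrier_vec m" and "0\<^sub>v m \<in> S"
    and "v \<in> S \<Longrightarrow> w \<in> S \<Longrightarrow> v + w \<in> S"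
    and "v \<in> S \<Longrightarrow> c \<cdot>\<^sub>v v \<in> S"
  using submodule.subset[OF assms] submodule.zero_closed[OF assms]
    submodule.m_closed[OF assms, of v w] submodule.smult_closed[OF assms, of c v]
  by (simp_all add: module_vec_simps)

text \<open>
  Together with \<open>reachable_space_image\<close> and \<open>reachable_space_invariant\<close> this characterizes
  \<open>\<langle>\<Lambda> | \<alpha>\<rangle>\<close> as the smallest \<open>\<Lambda>\<close>-invariant subspace that contains the image of \<open>\<alpha>\<close>.
\<close>

lemma reachable_space_subset:
  assumes \<Lambda>: "\<Lambda> \<in> carrier_mat m m" and \<alpha>: "\<alpha> \<in> carrier_mat m k"
    and S: "submodule class_ring S (module_vec TYPE(complex) m)"
    and image: "\<And>e. e \<in> carrier_vec k \<Longrightarrow> \<alpha> *\<^sub>v e \<in> S"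
    and invariant: "\<And>\<beta>. \<beta> \<in> S \<Longrightarrow> \<Lambda> *\<^sub>v \<beta> \<in> S"
  shows "reachable_space \<Lambda> \<alpha> \<subseteq> S"
proof -
  interpret X: vec_space "TYPE(complex)" m .
  have "(\<Lambda> ^\<^sub>m i * \<alpha>) *\<^sub>v e \<in> S" if "e \<in> carrier_vec k" for i e
  proof (induction i)
    case 0
    then show ?case using \<Lambda> \<alpha> that image by simp
  next
    case (Suc i)
    have "(\<Lambda> ^\<^sub>m Suc i * \<alpha>) *\<^sub>v e = (\<Lambda> * (\<Lambda> ^\<^sub>m i * \<alpha>)) *\<^sub>v e"
      using \<Lambda> \<alpha> by (simp add: pow_mat_commute[OF \<Lambda>, symmetric] assoc_mult_mat[of _ m m _ m _ k])
    also have "\<dots> = \<Lambda> *\<^sub>v ((\<Lambda> ^\<^sub>m i * \<alpha>) *\<^sub>v e)"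
      using \<Lambda> \<alpha> that by (intro assoc_mult_mat_vec[of _ m m _ k]) auto
    finally show ?case using invariant[OF Suc] by simp
  qed
  moreover have "col (\<Lambda> ^\<^sub>m i * \<alpha>) j = (\<Lambda> ^\<^sub>m i * \<alpha>) *\<^sub>v unit_vec k j" if "j < k" for i j
    using that \<Lambda> \<alpha> by (intro eq_vecI) auto
  ultimately have "(\<Union>i. set (cols (\<Lambda> ^\<^sub>m i * \<alpha>))) \<subseteq> S"
    using \<alpha> by (auto simp: cols_def)
  then show ?thesis
    using X.span_is_subset[OF _ S] \<Lambda> by (simp add: reachable_space_def)
qed

lemma reachable_space_image:
  assumes \<Lambda>: "\<Lambda> \<in> carrier_mat m m" and \<alpha>: "\<alpha> \<in> carrier_mat m k" and e: "e \<in> carrier_vec k"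
  shows "\<alpha> *\<^sub>v e \<in> reachable_space \<Lambda> \<alpha>"
proof -
  interpret X: vec_space "TYPE(complex)" m .
  have "\<alpha> *\<^sub>v e \<in> X.span (set (cols \<alpha>))"
    using X.col_space_eq[OF \<alpha>] \<alpha> e by (auto simp: X.col_space_def)
  moreover have "\<alpha> = \<Lambda> ^\<^sub>m 0 * \<alpha>" using \<Lambda> \<alpha> by simp
  then have "set (cols \<alpha>) \<subseteq> (\<Union>i. set (cols (\<Lambda> ^\<^sub>m i * \<alpha>)))" by (metis UN_upper UNIV_I)
  ultimately show ?thesis
    using subsetD[OF X.span_is_monotone] \<Lambda> by (simp add: reachable_space_def)
qed

lemma reachable_space_invariant:
  assumes \<Lambda>: "\<Lambda> \<in> carrier_mat m m" and \<alpha>: "\<alpha> \<in> carrier_mat m k"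
    and \<beta>: "\<beta> \<in> reachable_space \<Lambda> \<alpha>"
  shows "\<Lambda> *\<^sub>v \<beta> \<in> reachable_space \<Lambda> \<alpha>"
proof -
  interpret X: vec_space "TYPE(complex)" m .
  note sub = submodule_module_vecD[OF reachable_space_submodule[OF \<Lambda> \<alpha>]]
  let ?S = "{\<beta> \<in> carrier_vec m. \<Lambda> *\<^sub>v \<beta> \<in> reachable_space \<Lambda> \<alpha>}"
  let ?U = "\<Union>i. set (cols (\<Lambda> ^\<^sub>m i * \<alpha>))"
  note U = reachable_generators_carrier[OF \<Lambda> \<alpha>]
  have span: "reachable_space \<Lambda> \<alpha> = X.span ?U"
    using \<Lambda> by (simp add: reachable_space_def)
  have "submodule class_ring ?S X.V"
  proof (rule submodule_module_vecI)
    have "\<Lambda> *\<^sub>v 0\<^sub>v m = 0\<^sub>v m" using \<Lambda> by (intro eq_vecI) auto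
    then show "0\<^sub>v m \<in> ?S" using sub(2) by simp
  qed (use sub \<Lambda> in \<open>auto simp: mult_add_distrib_mat_vec[OF \<Lambda>] mult_mat_vec[OF \<Lambda>]\<close>)
  moreover have "?U \<subseteq> ?S"
  proof
    fix v assume v: "v \<in> ?U"
    then obtain i j where ij: "j < k" "v = col (\<Lambda> ^\<^sub>m i * \<alpha>) j"
      using \<alpha> by (auto simp: cols_def)
    have "\<Lambda> *\<^sub>v v = col (\<Lambda> * (\<Lambda> ^\<^sub>m i * \<alpha>)) j"
      unfolding ij(2) using ij(1) \<Lambda> \<alpha> by (subst col_mult2[of _ m m _ k]) auto
    also have "\<Lambda> * (\<Lambda> ^\<^sub>m i * \<alpha>) = \<Lambda> ^\<^sub>m Suc i * \<alpha>"
      using \<Lambda> \<alpha> by (simp add: pow_mat_commute[OF \<Lambda>, symmetric] assoc_mult_mat[of _ m m _ m _ k])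
    also have "col (\<Lambda> ^\<^sub>m Suc i * \<alpha>) j \<in> set (cols (\<Lambda> ^\<^sub>m Suc i * \<alpha>))"
      using ij(1) \<alpha> by (auto simp: cols_def)
    finally have "\<Lambda> *\<^sub>v v \<in> ?U" by (rule UN_I[OF UNIV_I])
    then have "\<Lambda> *\<^sub>v v \<in> reachable_space \<Lambda> \<alpha>"
      unfolding span by (rule subsetD[OF X.in_own_span[OF U]])
    then show "v \<in> ?S" using subsetD[OF U v] by blast
  qed
  ultimately have "X.span ?U \<subseteq> ?S" by (intro X.span_is_subset)
  then show ?thesis using \<beta> unfolding span by blast
qed

section \<open>Strictly proper and polynomial parts of vectors\<close>

lemma pi_minus_add_polynomial:
  assumes "g \<in> strictly_proper_vecs q" "u \<in> polynomial_vecs q"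
  shows "pi_minus (g + u) = g"
proof (rule eq_vecI)
  fix i assume i: "i < dim_vec g"
  then have "u $ i \<in> range to_fract"
    using assms by (auto simp: polynomial_vecs_def strictly_proper_vecs_def)
  then obtain p where "u $ i = to_fract p" by blast
  then show "pi_minus (g + u) $ i = g $ i"
    using i assms unfolding pi_minus_def
    by (auto simp: polynomial_vecs_def strictly_proper_vecs_def intro!: strictly_proper_part_eqI[of _ _ p])
qed (use assms in \<open>auto simp: pi_minus_def polynomial_vecs_def strictly_proper_vecs_def\<close>)

lemma pi_minus_decomposition:
  assumes "k \<in> carrier_vec q"
  obtains u where "u \<in> polynomial_vecs q" "pi_minus k \<in> strictly_proper_vecs q" "k = pi_minus k + u"
proof (rule that[of "k - pi_minus k"])
  show "k - pi_minus k \<in> polynomial_vecs q" "pi_minus k \<in> strictly_proper_vecs q"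
    using assms strictly_proper_part
    by (auto simp: pi_minus_def polynomial_vecs_def strictly_proper_vecs_def)
  show "k = pi_minus k + (k - pi_minus k)"
    using assms by (intro eq_vecI) (auto simp: pi_minus_def)
qed

lemma smult_zero_vec: "(a :: 'a :: mult_zero) \<cdot>\<^sub>v 0\<^sub>v q = 0\<^sub>v q"
  by (intro eq_vecI) auto

lemma ratvec_diff:
  assumes "x \<in> carrier_vec q" "y \<in> carrier_vec q"
  shows "ratvec (x - y) = ratvec x - ratvec y"
  using assms by (intro eq_vecI) auto

lemma mult_ratvec_diff:
  assumes G: "G \<in> carrier_mat q m" and "\<beta> \<in> carrier_vec m" "\<gamma> \<in> carrier_vec m"
  shows "G *\<^sub>v ratvec (\<beta> - \<gamma>) = G *\<^sub>v ratvec \<beta> - G *\<^sub>v ratvec \<gamma>"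
  using assms by (simp add: ratvec_diff[of _ m] mult_minus_distrib_mat_vec[OF G])

lemma ratvec_polynomial: "r \<in> carrier_vec q \<Longrightarrow> ratvec r \<in> polynomial_vecs q"
  by (auto simp: polynomial_vecs_def const_fract_def)

lemma polynomial_vecs_alt:
  assumes "u \<in> polynomial_vecs q"
  obtains p where "u = vec q (\<lambda>j. to_fract (p j))"
proof -
  have "\<exists>p. j < q \<longrightarrow> u $ j = to_fract p" for j
    using assms by (auto simp: polynomial_vecs_def)
  then obtain p where "\<And>j. j < q \<Longrightarrow> u $ j = to_fract (p j)" by metis
  then have "u = vec q (\<lambda>j. to_fract (p j))"
    using assms by (intro eq_vecI) (auto simp: polynomial_vecs_def)
  then show thesis by (rule that)
qed

section \<open>Kernel elements in coordinates\<close>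

locale fzk_basis = state_space_solution +
  assumes obs: "observable C A" and basis: "columns_basis_fzk F G"
begin

lemma dim_F: "dim_row F = p" "dim_col F = q"
  using F_carrier by auto

lemma mem_kernel_F: "v \<in> mat_kernel F \<longleftrightarrow> v \<in> carrier_vec q \<and> F *\<^sub>v v = 0\<^sub>v p"
  by (simp add: mat_kernel_def dim_F)

lemma strictly_proper_kernelD:
  assumes "v \<in> strictly_proper_kernel F"
  shows "v \<in> carrier_vec q" and "F *\<^sub>v v = 0\<^sub>v p"
  using assms by (simp_all add: strictly_proper_kernel_def mem_kernel_F)

lemma polynomial_vecs_carrier: "u \<in> polynomial_vecs r \<Longrightarrow> u \<in> carrier_vec r"
  by (simp add: polynomial_vecs_def)

lemmas coordinates = columns_basis_fzk_coordinates[OF dim_F(2) G_carrier basis]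

lemma G_ratvec_carrier: "\<beta> \<in> carrier_vec m \<Longrightarrow> G *\<^sub>v ratvec \<beta> \<in> carrier_vec q"
  using G_carrier by simp

lemma G_strictly_proper:
  assumes "\<beta> \<in> carrier_vec m"
  shows "G *\<^sub>v ratvec \<beta> \<in> strictly_proper_vecs q"
  using coordinates(1)[OF assms] by (simp add: fzk_numerator_def dim_F)

lemma G_in_kernel_imp_zero:
  assumes \<beta>: "\<beta> \<in> carrier_vec m" and ker: "F *\<^sub>v (G *\<^sub>v ratvec \<beta>) = 0\<^sub>v p"
  shows "\<beta> = 0\<^sub>v m"
  using coordinates(3)[OF \<beta>] G_strictly_proper[OF \<beta>] ker G_ratvec_carrier[OF \<beta>]
  by (simp add: strictly_proper_kernel_def mem_kernel_F dim_F)

text \<open>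
  A vector \<open>\<beta>\<close> annihilated by \<open>P\<close> forms with \<open>r = 0\<close> a zero-state solution.  Then \<open>G\<beta>\<close> is a strictly
  proper kernel element, its class is zero, and \<open>\<beta> = 0\<close> by independence.
\<close>

lemma P_injective:
  assumes \<beta>: "\<beta> \<in> carrier_vec m" and \<gamma>: "\<gamma> \<in> carrier_vec m" and eq: "P *\<^sub>v \<beta> = P *\<^sub>v \<gamma>"
  shows "\<beta> = \<gamma>"
proof -
  have d: "\<beta> - \<gamma> \<in> carrier_vec m" using \<beta> \<gamma> by simp
  have "P *\<^sub>v (\<beta> - \<gamma>) = 0\<^sub>v n"
    using P \<beta> \<gamma> by (simp add: mult_minus_distrib_mat_vec[OF P] eq)
  moreover have "B *\<^sub>v 0\<^sub>v q = 0\<^sub>v n" "D *\<^sub>v 0\<^sub>v q = 0\<^sub>v p"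
    using B D by (auto intro!: eq_vecI)
  ultimately have "F *\<^sub>v (G *\<^sub>v ratvec (\<beta> - \<gamma>) + ratvec (0\<^sub>v q)) = 0\<^sub>v p"
    using zero_state_imp_kernel[OF d, of "0\<^sub>v q"] by simp
  then have "F *\<^sub>v (G *\<^sub>v ratvec (\<beta> - \<gamma>)) = 0\<^sub>v p"
    using G_ratvec_carrier[OF d] by (simp add: const_fract.vec_hom_zero)
  then have "\<beta> - \<gamma> = 0\<^sub>v m" by (rule G_in_kernel_imp_zero[OF d])
  then have "(\<beta> - \<gamma>) + \<gamma> = 0\<^sub>v m + \<gamma>" by simp
  moreover have "(\<beta> - \<gamma>) + \<gamma> = \<beta>" using \<beta> \<gamma> by (intro eq_vecI) auto
  ultimately show ?thesis using \<gamma> by simp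
qed

text \<open>
  The strictly proper part of a kernel element belongs to \<open>F\<^sup>-\<^sup>1(\<Omega>Y) + \<Omega>U\<close>, so it has coordinates.
  Replacing it by \<open>G\<beta>\<close> changes the kernel element only by another kernel element.
\<close>

lemma strictly_proper_part_coordinates:
  assumes g: "g \<in> strictly_proper_vecs q" and u: "u \<in> polynomial_vecs q"
    and ker: "F *\<^sub>v (g + u) = 0\<^sub>v p"
  obtains \<beta> where "\<beta> \<in> carrier_vec m" and "g - G *\<^sub>v ratvec \<beta> \<in> strictly_proper_kernel F"
    and "F *\<^sub>v (G *\<^sub>v ratvec \<beta> + u) = 0\<^sub>v p"
proof -
  note gc = strictly_proper_vecs_carrier[OF g] and uc = polynomial_vecs_carrier[OF u]
  have "g + u \<in> inverse_image_poly F"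
    using gc uc ker submodule_rational_vecsD(1)[OF submodule_polynomial_vecs]
    by (simp add: inverse_image_poly_def dim_F)
  moreover have "- u \<in> polynomial_vecs q"
    using submodule_rational_vecsD(3)[OF submodule_polynomial_vecs u, of "- 1"]
    by (simp only: uminus_eq_smult)
  moreover have "g = (g + u) + (- u)" using gc uc by (intro eq_vecI) auto
  ultimately have "g \<in> set_add (rational_vecs q) (inverse_image_poly F) (polynomial_vecs q)"
    unfolding set_add_def' by (auto simp: rational_vecs_def)
  then have "g \<in> fzk_numerator F"
    using g by (simp add: fzk_numerator_def dim_F)
  then obtain \<beta> where \<beta>: "\<beta> \<in> carrier_vec m" "g - G *\<^sub>v ratvec \<beta> \<in> strictly_proper_kernel F"
    using coordinates(2) by blast
  note Gc = G_ratvec_carrier[OF \<beta>(1)]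
  have "h + u = (g + u) - (g - h)" if "h \<in> carrier_vec q" for h
    using gc uc that by (intro eq_vecI) auto
  from this[OF Gc] have "G *\<^sub>v ratvec \<beta> + u = (g + u) - (g - G *\<^sub>v ratvec \<beta>)" .
  also have "F *\<^sub>v \<dots> = 0\<^sub>v p"
    using ker strictly_proper_kernelD[OF \<beta>(2)] gc uc
    by (simp add: mult_minus_distrib_mat_vec[OF F_carrier])
  finally show thesis using that \<beta> by blast
qed

lemma zero_state_solution_iff:
  "zero_state_solution A B C D P R \<alpha> \<longleftrightarrow>
    (\<exists>k. R \<in> carrier_mat q k \<and> \<alpha> \<in> carrier_mat m k \<and> B * R = P * \<alpha> \<and> D * R = 0\<^sub>m p k)"
proof -
  have "four_block_mat A B C D * (0\<^sub>m n k @\<^sub>r R) = (P * \<alpha>) @\<^sub>r 0\<^sub>m p k \<longleftrightarrow>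
      B * R = P * \<alpha> \<and> D * R = 0\<^sub>m p k"
    if R: "R \<in> carrier_mat q k" and \<alpha>: "\<alpha> \<in> carrier_mat m k" for k
  proof -
    have "four_block_mat A B C D * (0\<^sub>m n k @\<^sub>r R) =
        (A * 0\<^sub>m n k + B * R) @\<^sub>r (C * 0\<^sub>m n k + D * R)"
      using A B C D R by (intro four_block_mat_mult_append_rows) auto
    also have "\<dots> = (B * R) @\<^sub>r (D * R)" using A B C D R by simp
    finally show ?thesis
      using append_rows_eqD[of "B * R" n k "P * \<alpha>" "D * R" p "0\<^sub>m p k"] B D P R \<alpha> by auto
  qed
  then show ?thesis using A B C P by (auto simp: zero_state_solution_def)
qed

text \<open>
  Appending the single column \<open>(r, \<gamma>)\<close> to \<open>(R\<^sub>0, \<alpha>\<^sub>0)\<close> gives another solution, and by maximality its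
  image is no larger; thus \<open>r = R\<^sub>0e\<close>.  Then \<open>P\<gamma> = Br = P\<alpha>\<^sub>0e\<close>, and \<open>P\<close> is injective.
\<close>

lemma maximal_solution_image:
  assumes max: "maximal_zero_state_solution A B C D P R\<^sub>0 \<alpha>\<^sub>0"
    and R\<^sub>0: "R\<^sub>0 \<in> carrier_mat q k" and \<alpha>\<^sub>0: "\<alpha>\<^sub>0 \<in> carrier_mat m k"
    and sol: "B * R\<^sub>0 = P * \<alpha>\<^sub>0" "D * R\<^sub>0 = 0\<^sub>m p k"
    and r: "r \<in> carrier_vec q" and \<gamma>: "\<gamma> \<in> carrier_vec m"
    and Br: "B *\<^sub>v r = P *\<^sub>v \<gamma>" and Dr: "D *\<^sub>v r = 0\<^sub>v p"
  shows "\<exists>e\<in>carrier_vec k. \<gamma> = \<alpha>\<^sub>0 *\<^sub>v e"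
proof -
  interpret X: vec_space "TYPE(complex)" q .
  define R where "R = mat_of_cols q (cols R\<^sub>0 @ [r])"
  define \<alpha> where "\<alpha> = mat_of_cols m (cols \<alpha>\<^sub>0 @ [\<gamma>])"
  have R: "R \<in> carrier_mat q (Suc k)" and \<alpha>: "\<alpha> \<in> carrier_mat m (Suc k)"
    using R\<^sub>0 \<alpha>\<^sub>0 by (simp_all add: R_def \<alpha>_def mat_of_cols_def)
  have colR: "col R j = (if j < k then col R\<^sub>0 j else r)"
    and col\<alpha>: "col \<alpha> j = (if j < k then col \<alpha>\<^sub>0 j else \<gamma>)" if "j < Suc k" for j
    using that R\<^sub>0 \<alpha>\<^sub>0 r \<gamma> by (simp_all add: R_def \<alpha>_def nth_append)
  have "col (B * R) j = col (P * \<alpha>) j" "col (D * R) j = col (0\<^sub>m p (Suc k)) j" if j: "j < Suc k" for j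
  proof -
    note cols = col_mult2[OF B R j] col_mult2[OF P \<alpha> j] col_mult2[OF D R j] colR[OF j] col\<alpha>[OF j]
    have "B *\<^sub>v col R\<^sub>0 j = P *\<^sub>v col \<alpha>\<^sub>0 j" and D0: "D *\<^sub>v col R\<^sub>0 j = 0\<^sub>v p" if "j < k"
      using arg_cong[OF sol(1), of "\<lambda>M. col M j"] arg_cong[OF sol(2), of "\<lambda>M. col M j"] that
      unfolding col_mult2[OF B R\<^sub>0 that] col_mult2[OF P \<alpha>\<^sub>0 that] col_mult2[OF D R\<^sub>0 that]
      by simp_all
    then show "col (B * R) j = col (P * \<alpha>) j" unfolding cols using Br by (cases "j < k") simp_all
    show "col (D * R) j = col (0\<^sub>m p (Suc k)) j" unfolding cols using D0 Dr j by (cases "j < k") simp_all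
  qed
  then have "B * R = P * \<alpha>" "D * R = 0\<^sub>m p (Suc k)"
    using B D P R \<alpha> by (auto intro!: mat_col_eqI)
  then have "zero_state_solution A B C D P R \<alpha>"
    unfolding zero_state_solution_iff using R \<alpha> by blast
  moreover have setR: "set (cols R) = insert r (set (cols R\<^sub>0))"
    using R\<^sub>0 r by (subst R_def, subst cols_mat_of_cols) (auto simp: cols_def)
  then have "X.col_space R\<^sub>0 \<subseteq> X.col_space R"
    unfolding X.col_space_def by (intro X.span_is_monotone) auto
  ultimately have "X.col_space R = X.col_space R\<^sub>0"
    using max B unfolding maximal_zero_state_solution_def by auto
  moreover have "r \<in> X.col_space R"
    using subsetD[OF X.in_own_span, of "set (cols R)" r] setR cols_dim[of R] R
    by (simp add: X.col_space_def)
  ultimately obtain e where e: "e \<in> carrier_vec k" "R\<^sub>0 *\<^sub>v e = r"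
    using X.col_space_eq[OF R\<^sub>0] R\<^sub>0 by auto
  have "P *\<^sub>v \<gamma> = (B * R\<^sub>0) *\<^sub>v e"
    unfolding Br[symmetric] e(2)[symmetric] using B R\<^sub>0 e(1) by simp
  also have "\<dots> = P *\<^sub>v (\<alpha>\<^sub>0 *\<^sub>v e)"
    unfolding sol(1) using P \<alpha>\<^sub>0 e(1) by simp
  finally have "\<gamma> = \<alpha>\<^sub>0 *\<^sub>v e" using P_injective \<gamma> \<alpha>\<^sub>0 e(1) by simp
  then show ?thesis using e(1) by blast
qed

end

section \<open>The classes of the kernel\<close>

locale fzk_maximal = fzk_basis +
  fixes k :: nat and R\<^sub>0 \<alpha>\<^sub>0 :: "complex mat"
  assumes max: "maximal_zero_state_solution A B C D P R\<^sub>0 \<alpha>\<^sub>0"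
    and R\<^sub>0: "R\<^sub>0 \<in> carrier_mat q k" and \<alpha>\<^sub>0: "\<alpha>\<^sub>0 \<in> carrier_mat m k"
    and sol: "B * R\<^sub>0 = P * \<alpha>\<^sub>0" "D * R\<^sub>0 = 0\<^sub>m p k"
begin

text \<open>
  The vectors \<open>\<beta>\<close> admitting such a polynomial \<open>u\<close> form a \<open>\<Lambda>\<close>-invariant subspace containing the image
  of \<open>\<alpha>\<^sub>0\<close>: for \<open>\<beta> = \<alpha>\<^sub>0e\<close> take \<open>u = R\<^sub>0e\<close>, and if \<open>u\<close> works for \<open>\<beta>\<close>, then \<open>H\<beta> + zu\<close> works for
  \<open>\<Lambda>\<beta>\<close> because \<open>z(G\<beta> + u)\<close> is again in the kernel.
\<close>

lemma reachable_imp_kernel: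
  assumes "\<beta> \<in> reachable_space \<Lambda> \<alpha>\<^sub>0"
  obtains u where "u \<in> polynomial_vecs q" "F *\<^sub>v (G *\<^sub>v ratvec \<beta> + u) = 0\<^sub>v p"
proof -
  let ?S = "{\<beta> \<in> carrier_vec m. \<exists>u\<in>polynomial_vecs q. F *\<^sub>v (G *\<^sub>v ratvec \<beta> + u) = 0\<^sub>v p}"
  note poly = submodule_rational_vecsD[OF submodule_polynomial_vecs[of q]]
  have memI: "\<beta> \<in> ?S" if "\<beta> \<in> carrier_vec m" "u \<in> polynomial_vecs q"
    "F *\<^sub>v (G *\<^sub>v ratvec \<beta> + u) = 0\<^sub>v p" for \<beta> u
    using that by blast
  have "reachable_space \<Lambda> \<alpha>\<^sub>0 \<subseteq> ?S"
  proof (rule reachable_space_subset[OF \<Lambda> \<alpha>\<^sub>0 submodule_module_vecI])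
    show "?S \<subseteq> carrier_vec m" by blast
    have "F *\<^sub>v 0\<^sub>v q = 0\<^sub>v p" using F_carrier by (intro eq_vecI) auto
    then show "0\<^sub>v m \<in> ?S"
      using poly(1) by (auto simp: mult_ratvec_zero[OF G_carrier] intro!: bexI[of _ "0\<^sub>v q"])
  next
    fix v w assume "v \<in> ?S" "w \<in> ?S"
    then obtain u u' where v: "v \<in> carrier_vec m" "u \<in> polynomial_vecs q"
        "F *\<^sub>v (G *\<^sub>v ratvec v + u) = 0\<^sub>v p"
      and w: "w \<in> carrier_vec m" "u' \<in> polynomial_vecs q"
        "F *\<^sub>v (G *\<^sub>v ratvec w + u') = 0\<^sub>v p" by blast
    note car = G_ratvec_carrier[OF v(1)] G_ratvec_carrier[OF w(1)]
      polynomial_vecs_carrier[OF v(2)] polynomial_vecs_carrier[OF w(2)]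
    have "G *\<^sub>v ratvec (v + w) + (u + u') = (G *\<^sub>v ratvec v + u) + (G *\<^sub>v ratvec w + u')"
      unfolding mult_ratvec_add[OF G_carrier v(1) w(1)] using car by (intro eq_vecI) auto
    also have "F *\<^sub>v \<dots> = 0\<^sub>v p"
      unfolding mult_add_distrib_mat_vec[OF F_carrier add_carrier_vec[OF car(1,3)]
          add_carrier_vec[OF car(2,4)]] v(3) w(3) by simp
    finally have ker: "F *\<^sub>v (G *\<^sub>v ratvec (v + w) + (u + u')) = 0\<^sub>v p" .
    show "v + w \<in> ?S"
      by (rule memI[OF add_carrier_vec[OF v(1) w(1)] poly(2)[OF v(2) w(2)] ker])
  next
    fix c v assume "v \<in> ?S"
    then obtain u where v: "v \<in> carrier_vec m" "u \<in> polynomial_vecs q"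
        "F *\<^sub>v (G *\<^sub>v ratvec v + u) = 0\<^sub>v p" by blast
    note car = G_ratvec_carrier[OF v(1)] polynomial_vecs_carrier[OF v(2)]
    have "G *\<^sub>v ratvec (c \<cdot>\<^sub>v v) + const_fract c \<cdot>\<^sub>v u = const_fract c \<cdot>\<^sub>v (G *\<^sub>v ratvec v + u)"
      unfolding mult_ratvec_smult[OF G_carrier v(1)] using car by (simp add: smult_add_distrib_vec)
    also have "F *\<^sub>v \<dots> = 0\<^sub>v p"
      using car v(3) by (subst mult_mat_vec[OF F_carrier]) auto
    finally have ker: "F *\<^sub>v (G *\<^sub>v ratvec (c \<cdot>\<^sub>v v) + const_fract c \<cdot>\<^sub>v u) = 0\<^sub>v p" .
    show "c \<cdot>\<^sub>v v \<in> ?S"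
      by (rule memI[OF smult_carrier_vec[THEN iffD2, OF v(1)] poly(3)[OF v(2)] ker])
  next
    fix e :: "complex vec" assume e: "e \<in> carrier_vec k"
    have "B *\<^sub>v (R\<^sub>0 *\<^sub>v e) = P *\<^sub>v (\<alpha>\<^sub>0 *\<^sub>v e)" "D *\<^sub>v (R\<^sub>0 *\<^sub>v e) = 0\<^sub>m p k *\<^sub>v e"
      using B D P R\<^sub>0 \<alpha>\<^sub>0 e sol by (metis assoc_mult_mat_vec)+
    moreover have "0\<^sub>m p k *\<^sub>v e = 0\<^sub>v p" using e by (intro eq_vecI) auto
    ultimately have ker: "F *\<^sub>v (G *\<^sub>v ratvec (\<alpha>\<^sub>0 *\<^sub>v e) + ratvec (R\<^sub>0 *\<^sub>v e)) = 0\<^sub>v p"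
      using zero_state_imp_kernel[of "\<alpha>\<^sub>0 *\<^sub>v e" "R\<^sub>0 *\<^sub>v e"] R\<^sub>0 \<alpha>\<^sub>0 e by simp
    have poly': "ratvec (R\<^sub>0 *\<^sub>v e) \<in> polynomial_vecs q"
      using R\<^sub>0 e by (intro ratvec_polynomial) simp
    show "\<alpha>\<^sub>0 *\<^sub>v e \<in> ?S"
      by (rule memI[OF mult_mat_vec_carrier[OF \<alpha>\<^sub>0 e] poly' ker])
  next
    fix v assume "v \<in> ?S"
    then obtain u where v: "v \<in> carrier_vec m" "u \<in> polynomial_vecs q"
        "F *\<^sub>v (G *\<^sub>v ratvec v + u) = 0\<^sub>v p" by blast
    have \<Lambda>v: "\<Lambda> *\<^sub>v v \<in> carrier_vec m" and Hv: "ratvec (H *\<^sub>v v) \<in> carrier_vec q"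
      using \<Lambda> H v(1) by simp_all
    note car = G_ratvec_carrier[OF v(1)] polynomial_vecs_carrier[OF v(2)] G_ratvec_carrier[OF \<Lambda>v] Hv
    have "G *\<^sub>v ratvec (\<Lambda> *\<^sub>v v) + (ratvec (H *\<^sub>v v) + z_fract \<cdot>\<^sub>v u) =
        z_fract \<cdot>\<^sub>v (G *\<^sub>v ratvec v + u)"
      using car by (simp add: smult_add_distrib_vec[of _ q] z_mult_G[OF v(1)] assoc_add_vec[of _ q])
    also have "F *\<^sub>v \<dots> = 0\<^sub>v p"
      using car v(3) by (subst mult_mat_vec[OF F_carrier]) auto
    finally have ker: "F *\<^sub>v (G *\<^sub>v ratvec (\<Lambda> *\<^sub>v v) + (ratvec (H *\<^sub>v v) + z_fract \<cdot>\<^sub>v u)) = 0\<^sub>v p" .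
    have poly': "ratvec (H *\<^sub>v v) + z_fract \<cdot>\<^sub>v u \<in> polynomial_vecs q"
    proof (rule poly(2))
      show "ratvec (H *\<^sub>v v) \<in> polynomial_vecs q"
        using H v(1) by (intro ratvec_polynomial) simp
      have "z_fract * x \<in> range to_fract" if "x \<in> range to_fract" for x
        using that unfolding z_fract_def by (metis imageE rangeI to_fract_mult)
      then show "z_fract \<cdot>\<^sub>v u \<in> polynomial_vecs q"
        using v(2) by (auto simp: polynomial_vecs_def)
    qed
    show "\<Lambda> *\<^sub>v v \<in> ?S" by (rule memI[OF \<Lambda>v poly' ker])
  qed
  then show thesis using assms that by blast
qed

text \<open>
  Induction on a bound \<open>N\<close> for the degrees of the polynomial part \<open>f\<close>; dividing the kernel element
  by \<open>z\<close> lowers this bound, and changes \<open>\<beta>\<close> to some \<open>\<beta>'\<close> with \<open>\<beta> - \<Lambda>\<beta>'\<close> in the image of \<open>\<alpha>\<^sub>0\<close>.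
\<close>

lemma kernel_imp_reachable:
  assumes "\<And>j i. j < q \<Longrightarrow> N \<le> i \<Longrightarrow> coeff (f j) i = 0" and "\<beta> \<in> carrier_vec m"
    and "F *\<^sub>v (G *\<^sub>v ratvec \<beta> + vec q (\<lambda>j. to_fract (f j))) = 0\<^sub>v p"
  shows "\<beta> \<in> reachable_space \<Lambda> \<alpha>\<^sub>0"
  using assms
proof (induction N arbitrary: f \<beta>)
  case 0
  then have "f j = 0" if "j < q" for j using that by (intro poly_eqI) auto
  then have "vec q (\<lambda>j. to_fract (f j)) = 0\<^sub>v q" by (intro eq_vecI) auto
  then have "F *\<^sub>v (G *\<^sub>v ratvec \<beta>) = 0\<^sub>v p"
    using "0.prems"(3) G_ratvec_carrier[OF "0.prems"(2)] by simp
  then have "\<beta> = 0\<^sub>v m" by (rule G_in_kernel_imp_zero[OF "0.prems"(2)])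
  then show ?case
    using submodule_module_vecD(2)[OF reachable_space_submodule[OF \<Lambda> \<alpha>\<^sub>0]] by simp
next
  case (Suc N)
  note \<beta> = Suc.prems(2)
  define c where "c = vec q (\<lambda>j. coeff (f j) 0)"
  \<comment> \<open>The polynomial part is \<open>c + z u\<close>, and the kernel element is \<open>z (g + u)\<close> with \<open>g\<close> strictly proper.\<close>
  define f' where "f' j = poly_shift 1 (f j)" for j
  define u where "u = vec q (\<lambda>j. to_fract (f' j))"
  define g where "g = inverse z_fract \<cdot>\<^sub>v (G *\<^sub>v ratvec \<beta> + ratvec c)"
  have f: "f j = pCons (coeff (f j) 0) (f' j)" for j
    by (rule poly_eqI) (simp add: f'_def coeff_poly_shift coeff_pCons split: nat.split)
  have c: "c \<in> carrier_vec q" and uc: "u \<in> carrier_vec q" and u: "u \<in> polynomial_vecs q"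
    by (auto simp: c_def u_def polynomial_vecs_def)
  note G\<beta> = G_ratvec_carrier[OF \<beta>]
  have gc: "g \<in> carrier_vec q" using G\<beta> c by (simp add: g_def)
  have zg: "z_fract \<cdot>\<^sub>v g = G *\<^sub>v ratvec \<beta> + ratvec c"
    unfolding g_def by (simp add: smult_smult_assoc)
  have "vec q (\<lambda>j. to_fract (f j)) = ratvec c + z_fract \<cdot>\<^sub>v u"
  proof (rule eq_vecI)
    fix j assume "j < dim_vec (ratvec c + z_fract \<cdot>\<^sub>v u)"
    then show "vec q (\<lambda>j. to_fract (f j)) $ j = (ratvec c + z_fract \<cdot>\<^sub>v u) $ j"
      using arg_cong[OF f[of j], of to_fract] by (simp add: c_def u_def to_fract_pCons)
  qed (simp add: c_def u_def)
  then have k: "G *\<^sub>v ratvec \<beta> + vec q (\<lambda>j. to_fract (f j)) = z_fract \<cdot>\<^sub>v (g + u)"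
    using G\<beta> c uc gc by (simp add: smult_add_distrib_vec[of _ q] zg assoc_add_vec[of _ q])
  have "z_fract \<cdot>\<^sub>v (F *\<^sub>v (g + u)) = 0\<^sub>v p"
    using Suc.prems(3) gc uc unfolding k by (simp add: mult_mat_vec[OF F_carrier])
  then have "inverse z_fract \<cdot>\<^sub>v (z_fract \<cdot>\<^sub>v (F *\<^sub>v (g + u))) = 0\<^sub>v p"
    by (simp add: smult_zero_vec)
  then have ker: "F *\<^sub>v (g + u) = 0\<^sub>v p" by (simp add: smult_smult_assoc)
  have "strictly_proper (g $ j)" if "j < q" for j
  proof -
    have "g $ j = (G *\<^sub>v ratvec \<beta>) $ j / z_fract + const_fract (c $ j) / z_fract"
      using that G\<beta> c by (simp add: g_def field_simps)
    then show ?thesis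
      using G_strictly_proper[OF \<beta>] that
      by (auto simp: strictly_proper_vecs_def intro!: strictly_proper_add
          strictly_proper_divide_z_fract strictly_proper_const_fract_divide_z_fract)
  qed
  then have "g \<in> strictly_proper_vecs q" using gc by (simp add: strictly_proper_vecs_def)
  then obtain \<beta>' where \<beta>': "\<beta>' \<in> carrier_vec m" "g - G *\<^sub>v ratvec \<beta>' \<in> strictly_proper_kernel F"
      "F *\<^sub>v (G *\<^sub>v ratvec \<beta>' + u) = 0\<^sub>v p"
    using strictly_proper_part_coordinates[OF _ u ker] by blast
  have reach': "\<beta>' \<in> reachable_space \<Lambda> \<alpha>\<^sub>0"
  proof (rule Suc.IH[OF _ \<beta>'(1)])
    show "coeff (f' j) i = 0" if "j < q" "N \<le> i" for j i
      using Suc.prems(1)[of j "Suc i"] that by (simp add: f'_def coeff_poly_shift)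
    show "F *\<^sub>v (G *\<^sub>v ratvec \<beta>' + vec q (\<lambda>j. to_fract (f' j))) = 0\<^sub>v p"
      using \<beta>'(3) by (simp add: u_def)
  qed
  have \<Lambda>\<beta>': "\<Lambda> *\<^sub>v \<beta>' \<in> carrier_vec m" and H\<beta>': "H *\<^sub>v \<beta>' \<in> carrier_vec q"
    using \<Lambda> H \<beta>'(1) by simp_all
  note G\<beta>' = G_ratvec_carrier[OF \<beta>'(1)] and G\<Lambda>\<beta>' = G_ratvec_carrier[OF \<Lambda>\<beta>']
  \<comment> \<open>The polynomial parts of \<open>z (g + u)\<close> and \<open>z (G \<beta>' + u)\<close> differ by a constant only.\<close>
  have "G *\<^sub>v ratvec (\<beta> - \<Lambda> *\<^sub>v \<beta>') + ratvec (c - H *\<^sub>v \<beta>') =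
      (G *\<^sub>v ratvec \<beta> - G *\<^sub>v ratvec (\<Lambda> *\<^sub>v \<beta>')) + (ratvec c - ratvec (H *\<^sub>v \<beta>'))"
    by (simp only: mult_ratvec_diff[OF G_carrier \<beta> \<Lambda>\<beta>'] ratvec_diff[OF c H\<beta>'])
  also have "\<dots> = (G *\<^sub>v ratvec \<beta> + ratvec c) - (G *\<^sub>v ratvec (\<Lambda> *\<^sub>v \<beta>') + ratvec (H *\<^sub>v \<beta>'))"
  proof -
    have "(a - b) + (x - y) = (a + x) - (b + y)"
      if "a \<in> carrier_vec q" "b \<in> carrier_vec q" "x \<in> carrier_vec q" "y \<in> carrier_vec q"
      for a b x y :: "ratfun vec"
      using that by (intro eq_vecI) auto
    from this[OF G\<beta> G\<Lambda>\<beta>'] show ?thesis using c H\<beta>' by simp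
  qed
  also have "\<dots> = z_fract \<cdot>\<^sub>v (g - G *\<^sub>v ratvec \<beta>')"
  proof -
    have "z_fract \<cdot>\<^sub>v a - z_fract \<cdot>\<^sub>v b = z_fract \<cdot>\<^sub>v (a - b)"
      if "a \<in> carrier_vec q" "b \<in> carrier_vec q" for a b
      using that by (intro eq_vecI) (auto simp: right_diff_distrib)
    from this[OF gc G\<beta>'] show ?thesis
      unfolding zg[symmetric] z_mult_G[OF \<beta>'(1), symmetric] .
  qed
  also have "F *\<^sub>v \<dots> = 0\<^sub>v p"
    using strictly_proper_kernelD[OF \<beta>'(2)] by (simp add: mult_mat_vec[OF F_carrier] smult_zero_vec)
  finally have ker': "F *\<^sub>v (G *\<^sub>v ratvec (\<beta> - \<Lambda> *\<^sub>v \<beta>') + ratvec (c - H *\<^sub>v \<beta>')) = 0\<^sub>v p" .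
  have d: "\<beta> - \<Lambda> *\<^sub>v \<beta>' \<in> carrier_vec m" "c - H *\<^sub>v \<beta>' \<in> carrier_vec q"
    using \<beta> \<Lambda>\<beta>' c H\<beta>' by simp_all
  obtain e where e: "e \<in> carrier_vec k" "\<beta> - \<Lambda> *\<^sub>v \<beta>' = \<alpha>\<^sub>0 *\<^sub>v e"
    using maximal_solution_image[OF max R\<^sub>0 \<alpha>\<^sub>0 sol d(2,1) kernel_imp_zero_state[OF obs d ker']]
    by (elim bexE)
  have "\<beta> = a + (\<beta> - a)" if "a \<in> carrier_vec m" for a
    using \<beta> that by (intro eq_vecI) auto
  from this[OF \<Lambda>\<beta>'] have "\<beta> = \<Lambda> *\<^sub>v \<beta>' + \<alpha>\<^sub>0 *\<^sub>v e" unfolding e(2) .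
  then show ?case
    using submodule_module_vecD(3)[OF reachable_space_submodule[OF \<Lambda> \<alpha>\<^sub>0]]
      reachable_space_invariant[OF \<Lambda> \<alpha>\<^sub>0 reach'] reachable_space_image[OF \<Lambda> \<alpha>\<^sub>0 e(1)] by simp
qed

lemma carrier_W_ker:
  "carrier (W_ker F) = {kernel_class F (G *\<^sub>v ratvec \<beta>) | \<beta>. \<beta> \<in> reachable_space \<Lambda> \<alpha>\<^sub>0}"
proof -
  note reach_carrier = submodule_module_vecD(1)[OF reachable_space_submodule[OF \<Lambda> \<alpha>\<^sub>0]]
  have carrier: "carrier (W_ker F) = kernel_class F ` pi_minus ` mat_kernel F"
    by (simp add: W_ker_def quotient_space_def kernel_class_def)
  show ?thesis
    unfolding carrier
  proof (intro equalityI subsetI)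
    fix X assume "X \<in> kernel_class F ` pi_minus ` mat_kernel F"
    then obtain v where v: "v \<in> mat_kernel F" "X = kernel_class F (pi_minus v)" by blast
    obtain u where u: "u \<in> polynomial_vecs q" "pi_minus v \<in> strictly_proper_vecs q" "v = pi_minus v + u"
      using pi_minus_decomposition[of v q] v(1) by (auto simp: mem_kernel_F)
    have "F *\<^sub>v (pi_minus v + u) = 0\<^sub>v p"
      using v(1) unfolding u(3)[symmetric] by (simp add: mem_kernel_F)
    then obtain \<beta> where \<beta>: "\<beta> \<in> carrier_vec m"
        "pi_minus v - G *\<^sub>v ratvec \<beta> \<in> strictly_proper_kernel F"
        "F *\<^sub>v (G *\<^sub>v ratvec \<beta> + u) = 0\<^sub>v p"
      using strictly_proper_part_coordinates[OF u(2,1)] by blast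
    obtain f where f: "u = vec q (\<lambda>j. to_fract (f j))"
      using polynomial_vecs_alt[OF u(1)] by blast
    have "\<beta> \<in> reachable_space \<Lambda> \<alpha>\<^sub>0"
    proof (rule kernel_imp_reachable[OF _ \<beta>(1) \<beta>(3)[unfolded f]])
      fix j i assume j: "j < q" and i: "Suc (\<Sum>j<q. degree (f j)) \<le> i"
      have "degree (f j) \<le> (\<Sum>j<q. degree (f j))" using j by (intro member_le_sum) auto
      then show "coeff (f j) i = 0" using i by (intro coeff_eq_0) simp
    qed
    moreover have "X = kernel_class F (G *\<^sub>v ratvec \<beta>)"
      unfolding v(2) using \<beta>(2) strictly_proper_vecs_carrier[OF u(2)] G_ratvec_carrier[OF \<beta>(1)]
      by (subst kernel_class_eq_iff) (simp_all add: dim_F)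
    ultimately show "X \<in> {kernel_class F (G *\<^sub>v ratvec \<beta>) | \<beta>. \<beta> \<in> reachable_space \<Lambda> \<alpha>\<^sub>0}" by blast
  next
    fix X assume "X \<in> {kernel_class F (G *\<^sub>v ratvec \<beta>) | \<beta>. \<beta> \<in> reachable_space \<Lambda> \<alpha>\<^sub>0}"
    then obtain \<beta> where \<beta>: "\<beta> \<in> reachable_space \<Lambda> \<alpha>\<^sub>0" "X = kernel_class F (G *\<^sub>v ratvec \<beta>)" by blast
    have \<beta>c: "\<beta> \<in> carrier_vec m" using \<beta>(1) reach_carrier by blast
    obtain u where u: "u \<in> polynomial_vecs q" "F *\<^sub>v (G *\<^sub>v ratvec \<beta> + u) = 0\<^sub>v p"
      using reachable_imp_kernel[OF \<beta>(1)] by blast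
    have "G *\<^sub>v ratvec \<beta> + u \<in> mat_kernel F"
      using u G_ratvec_carrier[OF \<beta>c] polynomial_vecs_carrier[OF u(1)] by (simp add: mem_kernel_F)
    then show "X \<in> kernel_class F ` pi_minus ` mat_kernel F"
      unfolding \<beta>(2) using pi_minus_add_polynomial[OF G_strictly_proper[OF \<beta>c] u(1)]
      by (metis imageI)
  qed
qed

end

theorem theorem3p5:
  fixes n p q m :: nat
    and A B C D H \<Lambda> P R\<^sub>0 \<alpha>\<^sub>0 :: "complex mat"
    and F :: "complex poly fract mat"
  assumes "A \<in> carrier_mat n n" and "B \<in> carrier_mat n q"
    and "C \<in> carrier_mat p n" and "D \<in> carrier_mat p q"
    and "F = transfer_function A B C D"
    and "observable C A"
    and "H \<in> carrier_mat q m" and "\<Lambda> \<in> carrier_mat m m"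
    and "columns_basis_fzk F (ratmat H * resolvent \<Lambda>)"
    and "P \<in> carrier_mat n m"
    and "four_block_mat A B C D * (P @\<^sub>r H) = (P * \<Lambda>) @\<^sub>r 0\<^sub>m p m"
    and "maximal_zero_state_solution A B C D P R\<^sub>0 \<alpha>\<^sub>0"
  shows "carrier (W_ker F) =
    {kernel_class F ((ratmat H * resolvent \<Lambda>) *\<^sub>v ratvec \<beta>) | \<beta>. \<beta> \<in> reachable_space \<Lambda> \<alpha>\<^sub>0}"
proof -
  have "A * P + B * H = P * \<Lambda>" and "C * P + D * H = 0\<^sub>m p m"
    using append_rows_eqD[of "A * P + B * H" n m "P * \<Lambda>" "C * P + D * H" p "0\<^sub>m p m"]
      assms(11) four_block_mat_mult_append_rows[OF assms(1-4,10,7)] assms(1-4,7,8,10)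
    by auto
  then interpret state_space_solution n p q m A B C D H \<Lambda> P
    by unfold_locales (use assms in auto)
  interpret fzk_basis n p q m A B C D H \<Lambda> P
    by unfold_locales (use assms in auto)
  obtain k where "R\<^sub>0 \<in> carrier_mat q k" "\<alpha>\<^sub>0 \<in> carrier_mat m k" "B * R\<^sub>0 = P * \<alpha>\<^sub>0" "D * R\<^sub>0 = 0\<^sub>m p k"
    using assms(12) zero_state_solution_iff by (auto simp: maximal_zero_state_solution_def)
  then interpret fzk_maximal n p q m A B C D H \<Lambda> P k R\<^sub>0 \<alpha>\<^sub>0
    by unfold_locales (use assms in auto)
  show ?thesis unfolding assms(5) by (rule carrier_W_ker)
qed

end
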